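(* Let $k\geq1$, $s\in\mathbb{C}$, $\epsilon\in\{\pm1\}$, and let $f:\mathbb{R}^k\setminus\{0\}\to\mathbb{C}$ be $C^\infty$ and homogeneous of type $(-s,\epsilon)$. Then: 1. $\sum_{0\neq n\in\mathbb{Z}^k}f(n)$ is h-summable if $(s,\epsilon)\neq(k,1)$. 2. Assume $x\in\mathbb{R}^k$, $x\notin\mathbb{Z}^k$. Then $\sum_{n\in\mathbb{Z}^k}f(x+n)$ is h-summable if $(s,\epsilon)\notin\{(k-i,(-1)^i):i=0,1,2,\dots\}$.
   Context: Homogeneity: $f:\mathbb{R}^k\setminus\{0\}\to\mathbb{C}$ is homogeneous of type $(\sigma,\epsilon)\in\mathbb{C}\times\{\pm1\}$ if $f(tx)=t^{\sigma}f(x)$ and $f(-x)=\epsilon f(x)$ for all $t>0$, $x\ne0$. t-summability: for an abelian group $\Gamma$, $a:\Gamma\to\mathbb{C}$ is t-summable if there is a finitely supported $c:\Gamma\to\mathbb{C}$ with $\sum c\neq0$ and $\sum_\gamma|(c*a)(\gamma)|<\infty$, where $(c*a)(\gamma)=\sum_{\gamma'}c(\gamma')a(\gamma-\gamma')$. h-summability (on $\mathbb{Q}^k$): for $t\in\mathbb{Q}^\times$ and $a:\mathbb{Q}^k\to\mathbb{C}$ put $(\rho(t)a)(x)=a(t^{-1}x)$. The function $a$ is h-summable if there is a finitely supported family $(c_t)_{t\in\mathbb{Q}^\times}$ of complex numbers with $\sum_tc_t\neq0$ such that $\sum_tc_t\rho(t)a$ is t-summable on the group $\Gamma=\mathbb{Q}^k$.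 For $M\subset\mathbb{Q}^k$ and $a:M\to\mathbb{C}$, the series $\sum_{n\in M}a(n)$ is h-summable if the extension of $a$ by zero to $\mathbb{Q}^k$ is h-summable. In 2, the series is indexed by $n\in\mathbb{Z}^k\subset\mathbb{Q}^k$ with $n$-th term $f(x+n)$. *)

theory Defs
  imports "HOL-Analysis.Analysis"
begin

text \<open>
  The class \<open>C\<^sup>n\<close> is only meant for open \<open>S\<close>: the derivative is the two-sided one
  (\<open>at x\<close>), and \<open>C\<^sup>n\<^sup>+\<^sup>1\<close> asks that all directional derivatives of the
  (differentiable) function be \<open>C\<^sup>n\<close>.
\<close>

primrec Ck_on :: "nat \<Rightarrow> ('a::real_normed_vector \<Rightarrow> 'b::real_normed_vector) \<Rightarrow> 'a set \<Rightarrow> bool"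
  where
    "Ck_on 0 f S \<longleftrightarrow> continuous_on S f"
  | "Ck_on (Suc n) f S \<longleftrightarrow>
       (\<forall>x\<in>S. f differentiable (at x)) \<and>
       (\<forall>v. Ck_on n (\<lambda>x. frechet_derivative f (at x) v) S)"

definition smooth_on :: "('a::real_normed_vector \<Rightarrow> 'b::real_normed_vector) \<Rightarrow> 'a set \<Rightarrow> bool"
  where "smooth_on f S \<longleftrightarrow> (\<forall>n. Ck_on n f S)"

text \<open>A function on \<open>\<real>\<^sup>k - {0}\<close> is a total function whose value at \<open>0\<close> is irrelevant.\<close>

definition homogeneous_of_type ::
    "(real ^ 'k \<Rightarrow> complex) \<Rightarrow> complex \<Rightarrow> int \<Rightarrow> bool"
  where "homogeneous_of_type f \<sigma> \<epsilon> \<longleftrightarrow>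
    (\<forall>x t. x \<noteq> 0 \<longrightarrow> t > 0 \<longrightarrow> f (t *\<^sub>R x) = complex_of_real t powr \<sigma> * f x) \<and>
    (\<forall>x. x \<noteq> 0 \<longrightarrow> f (- x) = of_int \<epsilon> * f x)"

definition supp :: "('a \<Rightarrow> complex) \<Rightarrow> 'a set"
  where "supp c = {g. c g \<noteq> 0}"

definition conv :: "('g::ab_group_add \<Rightarrow> complex) \<Rightarrow> ('g \<Rightarrow> complex) \<Rightarrow> 'g \<Rightarrow> complex"
  where "conv c a g = (\<Sum>h\<in>supp c. c h * a (g - h))"

definition t_summable :: "('g::ab_group_add \<Rightarrow> complex) \<Rightarrow> bool"
  where "t_summable a \<longleftrightarrow>
    (\<exists>c. finite (supp c) \<and> (\<Sum>h\<in>supp c. c h) \<noteq> 0 \<and>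
         (\<lambda>g. norm (conv c a g)) summable_on UNIV)"

definition rho :: "rat \<Rightarrow> (rat ^ 'k \<Rightarrow> complex) \<Rightarrow> rat ^ 'k \<Rightarrow> complex"
  where "rho t a x = a (inverse t *s x)"

text \<open>A family indexed by \<open>\<rat> - {0}\<close> is a function on \<open>rat\<close> that vanishes at \<open>0\<close>.\<close>

definition h_summable :: "(rat ^ 'k \<Rightarrow> complex) \<Rightarrow> bool"
  where "h_summable a \<longleftrightarrow>
    (\<exists>c :: rat \<Rightarrow> complex. c 0 = 0 \<and> finite (supp c) \<and> (\<Sum>t\<in>supp c. c t) \<noteq> 0 \<and>
         t_summable (\<lambda>x. \<Sum>t\<in>supp c. c t * rho t a x))"

definition h_summable_on :: "(rat ^ 'k \<Rightarrow> complex) \<Rightarrow> (rat ^ 'k) set \<Rightarrow> bool"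
  where "h_summable_on a M \<longleftrightarrow> h_summable (\<lambda>x. if x \<in> M then a x else 0)"

definition int_lattice :: "('a::ring_1 ^ 'k) set"
  where "int_lattice = {x. \<forall>i. x $ i \<in> \<int>}"

definition real_of_rat_vec :: "rat ^ 'k \<Rightarrow> real ^ 'k"
  where "real_of_rat_vec q = (\<chi> i. of_rat (q $ i))"

end

theory Submission
  imports Defs
begin

text \<open>
  Write a for the function n \<mapsto> f(n) on the nonzero lattice points, extended by 0.

  If \<epsilon> = -1, then a is odd and the combination a + \<rho>(-1) a vanishes. If
  \<epsilon> = 1, then s \<noteq> k, and there is a positive integer m with m^{k-s} \<noteq> 1. By
  homogeneity the combination a - m^{k-s} \<rho>(m) a, whose weights have a nonzero sum, is
  f * \<phi> with \<phi> = 1 - m^k 1_{m \<int>^k}; the weight is chosen so that the densities of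
  \<int>^k and m \<int>^k cancel and \<phi> has mean 0 over each set of representatives
  J modulo m (\<open>homogeneous_h_space\<close>).

  Such a product is t-summable (\<open>oscillating_t_space\<close>). Summing f \<phi> over its
  translates by J replaces it, because \<phi> has mean 0, by
  \<Sum>_{j \<in> J} \<phi>(x - j) (f(x - j) - f(x)): again products with functions of mean 0, but
  with differences of f in place of f. Each repetition gains one order of decay at infinity,
  since a difference is controlled by a derivative, which for a homogeneous function is homogeneous
  of degree one less (\<open>homogeneous_symbol\<close>, \<open>symbol_difference\<close>). After enough repetitions
  the series converges absolutely.

  For the shifted series, the Taylor expansion of f(x + n) in x
  (\<open>taylor_remainder_order\<close>) gives finitely many functions
  D_x^i f(n) / i!, homogeneous of type (-s-i, (-1)^i \<epsilon>), and an absolutely summable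
  remainder. The excluded values of (s, \<epsilon>) are those for which some
  D_x^i f has type (-k, 1).

  That summable functions may be added, and that it suffices to treat an average, is common to
  translations and dilations: both act by commuting maps. The set \<open>averaged \<Theta> V\<close> of all functions that
  some weighted combination of maps from \<open>\<Theta>\<close> sends into \<open>V\<close> has these properties
  (\<open>averaged_add\<close>, \<open>averaged_saturated\<close>). With V the absolutely summable functions
  it yields the t-summable functions, and with these as V the h-summable ones.
\<close>


section \<open>Averaging by commuting maps\<close>

text \<open>
The linear span of the operators a \<mapsto> a \<circ> \<theta>, where the number \<open>z\<close> in
\<open>map_comb \<Theta> z T\<close> is the sum of the weights of \<open>T\<close>. Recording the operator together with this sum
instead of a finitely supported family of weights keeps the supports of sums and convolutions of such
families out of the proofs.
\<close>

inductive map_comb :: "('x \<Rightarrow> 'x) set \<Rightarrow> complex \<Rightarrow> (('x \<Rightarrow> complex) \<Rightarrow> 'x \<Rightarrow> complex) \<Rightarrow> bool"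
  for \<Theta> where
    zero: "map_comb \<Theta> 0 (\<lambda>a x. 0)"
  | add: "\<theta> \<in> \<Theta> \<Longrightarrow> map_comb \<Theta> z T \<Longrightarrow> map_comb \<Theta> (c + z) (\<lambda>a x. c * a (\<theta> x) + T a x)"

lemma map_comb_linear:
  assumes "map_comb \<Theta> z T"
  shows "T (\<lambda>x. a x + b x) x = T a x + T b x"
    and "T (\<lambda>x. c * a x) x = c * T a x"
  using assms by (induction) (auto simp: algebra_simps)

lemma map_comb_single: "\<theta> \<in> \<Theta> \<Longrightarrow> map_comb \<Theta> c (\<lambda>a x. c * a (\<theta> x))"
  using map_comb.add[OF _ map_comb.zero, of \<theta> \<Theta> c] by simp

lemma map_comb_sum:
  assumes "finite J" "\<And>j. j \<in> J \<Longrightarrow> \<theta> j \<in> \<Theta>"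
  shows "map_comb \<Theta> (\<Sum>j\<in>J. c j) (\<lambda>a x. \<Sum>j\<in>J. c j * a (\<theta> j x))"
  using assms
proof (induction J)
  case empty
  then show ?case by (simp add: map_comb.zero)
next
  case (insert j J)
  then show ?case using map_comb.add[of "\<theta> j" \<Theta> _ _ "c j"] by simp
qed

lemma map_comb_add:
  assumes "map_comb \<Theta> z T" "map_comb \<Theta> w U"
  shows "map_comb \<Theta> (z + w) (\<lambda>a x. T a x + U a x)"
  using assms
proof (induction)
  case (add \<theta> z T c)
  from map_comb.add[OF add.hyps(1) add.IH[OF add.prems], of c] show ?case by (simp add: add.assoc)
qed simp

definition averaged :: "('x \<Rightarrow> 'x) set \<Rightarrow> ('x \<Rightarrow> complex) set \<Rightarrow> ('x \<Rightarrow> complex) set"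
  where "averaged \<Theta> V = {a. \<exists>z T. map_comb \<Theta> z T \<and> z \<noteq> 0 \<and> T a \<in> V}"

lemma averagedI: "map_comb \<Theta> z T \<Longrightarrow> z \<noteq> 0 \<Longrightarrow> T a \<in> V \<Longrightarrow> a \<in> averaged \<Theta> V"
  by (auto simp: averaged_def)

locale invariant_space =
  fixes \<Theta> :: "('x \<Rightarrow> 'x) set" and V :: "('x \<Rightarrow> complex) set"
  assumes id_mem: "(\<lambda>x. x) \<in> \<Theta>"
    and comp_mem: "\<And>\<theta> \<eta>. \<theta> \<in> \<Theta> \<Longrightarrow> \<eta> \<in> \<Theta> \<Longrightarrow> (\<lambda>x. \<theta> (\<eta> x)) \<in> \<Theta>"
    and commute: "\<And>\<theta> \<eta> x. \<theta> \<in> \<Theta> \<Longrightarrow> \<eta> \<in> \<Theta> \<Longrightarrow> \<theta> (\<eta> x) = \<eta> (\<theta> x)"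
    and zero_mem: "(\<lambda>x. 0) \<in> V"
    and add_mem: "\<And>a b. a \<in> V \<Longrightarrow> b \<in> V \<Longrightarrow> (\<lambda>x. a x + b x) \<in> V"
    and scale_mem: "\<And>c a. a \<in> V \<Longrightarrow> (\<lambda>x. c * a x) \<in> V"
    and map_mem: "\<And>\<theta> a. \<theta> \<in> \<Theta> \<Longrightarrow> a \<in> V \<Longrightarrow> (\<lambda>x. a (\<theta> x)) \<in> V"
begin

lemma map_comb_comp_map:
  assumes "map_comb \<Theta> z T" "\<theta> \<in> \<Theta>"
  shows "map_comb \<Theta> (c * z) (\<lambda>a x. c * T a (\<theta> x))"
  using assms
proof (induction)
  case zero
  then show ?case using map_comb.zero by simp
next
  case (add \<eta> z T d)
  from map_comb.add[OF comp_mem[OF add.hyps(1) add.prems] add.IH[OF add.prems], of "c * d"]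
  show ?case by (simp add: algebra_simps)
qed

lemma map_comb_comp:
  assumes "map_comb \<Theta> z T" "map_comb \<Theta> w U"
  shows "map_comb \<Theta> (z * w) (\<lambda>a. T (U a))"
  using assms
proof (induction)
  case zero
  then show ?case using map_comb.zero by simp
next
  case (add \<eta> z T d)
  from map_comb_add[OF map_comb_comp_map[OF add.prems add.hyps(1), of d] add.IH[OF add.prems]]
  show ?case by (simp add: algebra_simps)
qed

lemma map_comb_commute_map:
  assumes "map_comb \<Theta> z T" "\<theta> \<in> \<Theta>"
  shows "T (\<lambda>x. a (\<theta> x)) x = T a (\<theta> x)"
  using assms by induction (auto simp: commute)

lemma map_comb_commute:
  assumes "map_comb \<Theta> z T" "map_comb \<Theta> w U"
  shows "T (U a) x = U (T a) x"
  using assms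
proof (induction arbitrary: x)
  case zero
  then show ?case using map_comb_linear(2)[OF zero, of 0 a x] by simp
next
  case (add \<eta> z T d)
  then show ?case
    by (simp add: map_comb_linear[OF add.prems] map_comb_commute_map)
qed

lemma map_comb_mem:
  assumes "map_comb \<Theta> z T" "a \<in> V"
  shows "T a \<in> V"
  using assms by induction (auto intro: zero_mem add_mem[OF scale_mem] map_mem)

lemma averaged_superset: "V \<subseteq> averaged \<Theta> V"
  using map_comb_single[OF id_mem, of 1] by (force simp: averaged_def)

text \<open>
If \<open>T\<close> sends \<open>a\<close> into \<open>V\<close> and \<open>U\<close> sends \<open>b\<close> into \<open>V\<close>, the product of the two commuting operators
sends both into \<open>V\<close>, and its weights sum to the product of the two sums.
\<close>

lemma averaged_add:
  assumes "a \<in> averaged \<Theta> V" "b \<in> averaged \<Theta> V"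
  shows "(\<lambda>x. a x + b x) \<in> averaged \<Theta> V"
proof -
  obtain z T w U where *: "map_comb \<Theta> z T" "z \<noteq> 0" "T a \<in> V" "map_comb \<Theta> w U" "w \<noteq> 0" "U b \<in> V"
    using assms by (auto simp: averaged_def)
  have "(\<lambda>x. U (T a) x + T (U b) x) \<in> V"
    by (intro add_mem map_comb_mem[OF *(4)] map_comb_mem[OF *(1)] *)
  also have "(\<lambda>x. U (T a) x + T (U b) x) = T (U (\<lambda>x. a x + b x))"
    using map_comb_linear(1)[OF map_comb_comp[OF *(1,4)], of a b] map_comb_commute[OF *(1,4), of a]
    by (intro ext) simp
  finally show ?thesis
    using averagedI[OF map_comb_comp[OF *(1,4)]] * by simp
qed

lemma averaged_scale:
  assumes "a \<in> averaged \<Theta> V"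
  shows "(\<lambda>x. c * a x) \<in> averaged \<Theta> V"
proof -
  obtain z T where *: "map_comb \<Theta> z T" "z \<noteq> 0" "T a \<in> V"
    using assms by (auto simp: averaged_def)
  have "T (\<lambda>x. c * a x) = (\<lambda>x. c * T a x)"
    by (intro ext map_comb_linear(2)[OF *(1)])
  with scale_mem[OF *(3), of c] show ?thesis using averagedI[OF *(1,2)] by simp
qed

lemma averaged_sum:
  assumes "finite J" "\<And>j. j \<in> J \<Longrightarrow> a j \<in> averaged \<Theta> V"
  shows "(\<lambda>x. \<Sum>j\<in>J. a j x) \<in> averaged \<Theta> V"
  using assms
  by (induction J) (auto intro: averaged_add subsetD[OF averaged_superset zero_mem])

lemma averaged_saturated:
  assumes "map_comb \<Theta> z T" "z \<noteq> 0" "T a \<in> averaged \<Theta> V"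
  shows "a \<in> averaged \<Theta> V"
proof -
  obtain w U where *: "map_comb \<Theta> w U" "w \<noteq> 0" "U (T a) \<in> V"
    using assms by (auto simp: averaged_def)
  then show ?thesis using averagedI[OF map_comb_comp[OF *(1) assms(1)]] assms(2) by simp
qed

text \<open>
Conjugation by \<open>\<psi>\<close> turns an operator that averages \<open>a\<close> into one that averages \<open>a \<circ> \<psi>\<close>; it will be
used for a dilation \<open>\<psi>\<close> and translations \<open>\<theta>\<close>.
\<close>

lemma averaged_map:
  assumes "a \<in> averaged \<Theta> V"
    and V: "\<And>b. b \<in> V \<Longrightarrow> (\<lambda>x. b (\<psi> x)) \<in> V"
    and normal: "\<And>\<theta>. \<theta> \<in> \<Theta> \<Longrightarrow> \<exists>\<theta>'\<in>\<Theta>. \<forall>x. \<theta> (\<psi> x) = \<psi> (\<theta>' x)"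
  shows "(\<lambda>x. a (\<psi> x)) \<in> averaged \<Theta> V"
proof -
  have twist: "\<exists>T'. map_comb \<Theta> z T' \<and> (\<forall>a x. T' (\<lambda>x. a (\<psi> x)) x = T a (\<psi> x))" if "map_comb \<Theta> z T" for z T
    using that
  proof induction
    case zero
    show ?case by (intro exI[of _ "\<lambda>a x. 0"]) (simp add: map_comb.zero)
  next
    case (add \<theta> z T c)
    then obtain T' where T': "map_comb \<Theta> z T'" "\<And>a x. T' (\<lambda>x. a (\<psi> x)) x = T a (\<psi> x)" by blast
    obtain \<theta>' where t: "\<theta>' \<in> \<Theta>" "\<And>x. \<theta> (\<psi> x) = \<psi> (\<theta>' x)" using normal[OF add.hyps(1)] by blast
    show ?case
      by (rule exI[of _ "\<lambda>a x. c * a (\<theta>' x) + T' a x"]) (use map_comb.add[OF t(1) T'(1)] T' t in auto)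
  qed
  obtain z T where *: "map_comb \<Theta> z T" "z \<noteq> 0" "T a \<in> V"
    using assms by (auto simp: averaged_def)
  obtain T' where T': "map_comb \<Theta> z T'" "\<And>a x. T' (\<lambda>x. a (\<psi> x)) x = T a (\<psi> x)"
    using twist[OF *(1)] by blast
  have "T' (\<lambda>x. a (\<psi> x)) = (\<lambda>x. T a (\<psi> x))" by (intro ext T'(2))
  with V[OF *(3)] show ?thesis using averagedI[OF T'(1) *(2)] by simp
qed

end

lemma supp_sum_mono:
  assumes "finite A" "supp c \<subseteq> A"
  shows "(\<Sum>g\<in>supp c. c g * F g) = (\<Sum>g\<in>A. c g * F g)"
  using assms by (intro sum.mono_neutral_left) (auto simp: supp_def)

text \<open>
When the maps are indexed by \<open>G\<close>, an operator comes from a finitely supported family of weights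
on \<open>G\<close>, the form in which summability is defined.
\<close>

lemma map_comb_coefficients:
  assumes "map_comb (\<theta> ` G) z T"
  obtains c where "finite (supp c)" "supp c \<subseteq> G" "(\<Sum>g\<in>supp c. c g) = z"
    "\<And>a x. T a x = (\<Sum>g\<in>supp c. c g * a (\<theta> g x))"
proof -
  have "\<exists>c. finite (supp c) \<and> supp c \<subseteq> G \<and> (\<Sum>g\<in>supp c. c g) = z \<and>
      (\<forall>a x. T a x = (\<Sum>g\<in>supp c. c g * a (\<theta> g x)))"
    using assms
  proof induction
    case zero
    show ?case by (intro exI[of _ "\<lambda>_. 0"]) (simp add: supp_def)
  next
    case (add \<eta> z T d)
    obtain h where h: "h \<in> G" "\<eta> = \<theta> h" using add.hyps(1) by blast
    obtain c where c: "finite (supp c)" "supp c \<subseteq> G" "(\<Sum>g\<in>supp c. c g) = z"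
      "\<And>a x. T a x = (\<Sum>g\<in>supp c. c g * a (\<theta> g x))" using add.IH by blast
      \<comment> \<open>The new weight may cancel the old one at \<open>h\<close>, so sums are compared over a common set instead of over the two supports.\<close>
  define A where "A = insert h (supp c)"
    define c' where "c' = c(h := c h + d)"
    have A: "finite A" "supp c \<subseteq> A" "supp c' \<subseteq> A" "h \<in> A"
      using c(1) by (auto simp: A_def c'_def supp_def)
    have key: "(\<Sum>g\<in>supp c'. c' g * F g) = d * F h + (\<Sum>g\<in>supp c. c g * F g)" for F :: "_ \<Rightarrow> complex"
    proof -
      have "(\<Sum>g\<in>A. c' g * F g) = (\<Sum>g\<in>A. c g * F g + (if g = h then d * F h else 0))"
        by (intro sum.cong) (auto simp: c'_def algebra_simps)
      also have "\<dots> = (\<Sum>g\<in>A. c g * F g) + d * F h"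
        using A by (simp add: sum.distrib)
      finally show ?thesis using A by (simp add: supp_sum_mono[of A])
    qed
    show ?case
      using finite_subset[OF A(3,1)] A(3) c h key[of "\<lambda>_. 1"] key
      by (intro exI[of _ c']) (auto simp: A_def)
  qed
  then show ?thesis using that by blast
qed

section \<open>Functions with decaying derivatives\<close>

definition order_at_infinity :: "real \<Rightarrow> ('a::real_normed_vector \<Rightarrow> 'b::real_normed_vector) \<Rightarrow> bool"
  where "order_at_infinity p G \<longleftrightarrow> (\<exists>C K. \<forall>x. norm x \<ge> K \<longrightarrow> norm (G x) \<le> C * norm x powr p)"

lemma order_at_infinityE:
  assumes "order_at_infinity p G"
  obtains C K where "C \<ge> 0" "K > 0" "\<And>x. norm x \<ge> K \<Longrightarrow> norm (G x) \<le> C * norm x powr p"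
proof -
  obtain C K where *: "\<And>x. norm x \<ge> K \<Longrightarrow> norm (G x) \<le> C * norm x powr p"
    using assms by (auto simp: order_at_infinity_def)
  show ?thesis
  proof (rule that)
    show "\<bar>C\<bar> \<ge> 0" "max K 1 > 0" by auto
    fix x :: 'a assume x: "norm x \<ge> max K 1"
    have "norm (G x) \<le> C * norm x powr p" using * x by simp
    also have "\<dots> \<le> \<bar>C\<bar> * norm x powr p" by (intro mult_right_mono) auto
    finally show "norm (G x) \<le> \<bar>C\<bar> * norm x powr p" .
  qed
qed

lemma powr_le_of_comparable:
  fixes a b p :: real
  assumes "a > 0" "a \<le> 2 * b" "b \<le> 2 * a"
  shows "b powr p \<le> 2 powr \<bar>p\<bar> * a powr p"
proof (cases "p \<ge> 0")
  case True
  have "b powr p \<le> (2 * a) powr p" using assms True by (intro powr_mono2) auto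
  then show ?thesis using assms True by (simp add: powr_mult)
next
  case False
  have "b powr p \<le> (a / 2) powr p" using assms False by (intro powr_mono2') auto
  also have "\<dots> = 2 powr \<bar>p\<bar> * a powr p" 
    using assms False by (simp add: powr_divide powr_minus divide_simps)
  finally show ?thesis .
qed

text \<open>
A shift of bounded length changes the norm of a far away point by a factor of at most 2.
\<close>

lemma order_shifts:
  fixes G :: "'a::real_normed_vector \<Rightarrow> 'b::real_normed_vector"
  assumes "order_at_infinity p G" and "r \<ge> 0"
  obtains C K where "C \<ge> 0" "K > 0"
    "\<And>x h. norm x \<ge> K \<Longrightarrow> norm h \<le> r \<Longrightarrow> norm (G (x + h)) \<le> C * norm x powr p"
proof -
  obtain C K where *: "C \<ge> 0" "K > 0" "\<And>x. norm x \<ge> K \<Longrightarrow> norm (G x) \<le> C * norm x powr p"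
    using order_at_infinityE[OF assms(1)] by blast
  show ?thesis
  proof (rule that)
    show "C * 2 powr \<bar>p\<bar> \<ge> 0" using * by simp
    show "K + 2 * r > 0" using * assms by simp
    fix x h :: 'a assume x: "norm x \<ge> K + 2 * r" "norm h \<le> r"
    have "norm (x + h) \<ge> norm x - norm h" "norm (x + h) \<le> norm x + norm h"
      using norm_diff_ineq norm_triangle_ineq by blast+
    then have n: "norm (x + h) \<ge> K" "norm x > 0" "norm x \<le> 2 * norm (x + h)" "norm (x + h) \<le> 2 * norm x"
      using x * assms by linarith+
    have "norm (G (x + h)) \<le> C * norm (x + h) powr p" using * n by blast
    also have "\<dots> \<le> C * (2 powr \<bar>p\<bar> * norm x powr p)"
      by (intro mult_left_mono powr_le_of_comparable n *)
    finally show "norm (G (x + h)) \<le> C * 2 powr \<bar>p\<bar> * norm x powr p" by (simp add: mult.assoc)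
  qed
qed

text \<open>
The functions of order p whose iterated directional derivatives up to the \<open>n\<close>-th exist near
infinity and lose one order each. In contrast to homogeneity, this is inherited by
differences G(x - h) - G(x).
\<close>

primrec symbol :: "nat \<Rightarrow> real \<Rightarrow> ('a::real_normed_vector \<Rightarrow> 'b::real_normed_vector) \<Rightarrow> bool"
  where
    "symbol 0 p G \<longleftrightarrow> order_at_infinity p G"
  | "symbol (Suc n) p G \<longleftrightarrow> order_at_infinity p G \<and> 
       (\<exists>K. \<forall>x. norm x > K \<longrightarrow> G differentiable (at x)) \<and>
       (\<forall>v. symbol n (p - 1) (\<lambda>x. frechet_derivative G (at x) v))"

lemma symbol_order: "symbol n p G \<Longrightarrow> order_at_infinity p G"
  by (cases n) auto

lemma open_norm_gt: "open {x::'a::real_normed_vector. norm x > K}"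
  by (intro open_Collect_less continuous_intros)

lemma order_at_infinity_cong:
  fixes G H :: "'a::real_normed_vector \<Rightarrow> 'b::real_normed_vector"
  assumes "order_at_infinity p G" "\<And>x. norm x > L \<Longrightarrow> G x = H x"
  shows "order_at_infinity p H"
proof -
  obtain C K where *: "C \<ge> 0" "K > 0" "\<And>x. norm x \<ge> K \<Longrightarrow> norm (G x) \<le> C * norm x powr p"
    using order_at_infinityE[OF assms(1)] by blast
  show ?thesis unfolding order_at_infinity_def
  proof (intro exI allI impI)
    fix x :: 'a assume x: "norm x \<ge> max K (L + 1)"
    then show "norm (H x) \<le> C * norm x powr p" using *(3)[of x] assms(2)[of x] by simp
  qed
qed

lemma symbol_cong:
  fixes G H :: "'a::real_normed_vector \<Rightarrow> 'b::real_normed_vector"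
  assumes "symbol n p G" "\<And>x. norm x > L \<Longrightarrow> G x = H x"
  shows "symbol n p H"
  using assms
proof (induction n arbitrary: p G H L)
  case 0
  then show ?case using order_at_infinity_cong[of p G L H] by simp
next
  case (Suc n)
  obtain K where K: "\<And>x. norm x > K \<Longrightarrow> G differentiable (at x)" using Suc.prems(1) by auto
  have d: "(H has_derivative frechet_derivative G (at x)) (at x)" if "norm x > max K L" for x :: 'a
  proof (rule has_derivative_transform_within_open[OF _ open_norm_gt[of L]])
    show "(G has_derivative frechet_derivative G (at x)) (at x)"
      using K that by (auto simp: frechet_derivative_works[symmetric])
  qed (use that Suc.prems in auto)
  have "symbol n (p - 1) (\<lambda>x. frechet_derivative H (at x) v)" for v
  proof (rule Suc.IH)
    show "symbol n (p - 1) (\<lambda>x. frechet_derivative G (at x) v)" using Suc.prems by simp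
    show "frechet_derivative G (at x) v = frechet_derivative H (at x) v" if "norm x > max K L" for x :: 'a
      using fun_cong[OF frechet_derivative_at[OF d[OF that]]] .
  qed
  moreover have "order_at_infinity p H"
    using Suc.prems order_at_infinity_cong[of p G L H] by simp
  moreover have "\<forall>x. norm x > max K L \<longrightarrow> H differentiable (at x)"
    by (intro allI impI differentiableI[OF d])
  ultimately show ?case unfolding symbol.simps by (intro conjI exI[of _ "max K L"]) simp_all
qed

lemma mean_value_bound:
  fixes G :: "real \<Rightarrow> 'b::real_normed_vector"
  assumes "\<And>u. u \<in> {0..t} \<Longrightarrow> (G has_vector_derivative G' u) (at u)"
    and "\<And>u. u \<in> {0..t} \<Longrightarrow> norm (G' u) \<le> B" and "0 \<le> t"
  shows "norm (G t - G 0) \<le> B * t"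
proof -
  have "norm (G t - G 0) \<le> B * norm (t - 0)"
  proof (rule differentiable_bound[of "{0..t}" G "\<lambda>u h. h *\<^sub>R G' u"])
    fix u assume u: "u \<in> {0..t}"
    show "(G has_derivative (\<lambda>h. h *\<^sub>R G' u)) (at u within {0..t})"
      using assms(1)[OF u] by (auto simp: has_vector_derivative_def intro: has_derivative_at_withinI)
    show "onorm (\<lambda>h. h *\<^sub>R G' u) \<le> B"
      by (rule onorm_le) (use assms(2)[OF u] in \<open>simp add: mult.commute[of B] mult_left_mono\<close>)
  qed (use assms in auto)
  then show ?thesis using assms by simp
qed

lemma has_vector_derivative_along_line:
  assumes "G differentiable (at (x + u *\<^sub>R v))"
  shows "((\<lambda>u. G (x + u *\<^sub>R v)) has_vector_derivative frechet_derivative G (at (x + u *\<^sub>R v)) v) (at u)"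
proof -
  have "((\<lambda>u. x + u *\<^sub>R v) has_vector_derivative v) (at u)"
    by (auto intro!: derivative_eq_intros)
  moreover have "(G has_derivative frechet_derivative G (at (x + u *\<^sub>R v))) (at (x + u *\<^sub>R v))"
    using assms by (simp add: frechet_derivative_works[symmetric])
  ultimately have "(G \<circ> (\<lambda>u. x + u *\<^sub>R v) has_vector_derivative frechet_derivative G (at (x + u *\<^sub>R v)) v) (at u)"
    by (rule vector_derivative_diff_chain_within[of _ _ _ UNIV, simplified, OF _ has_derivative_at_withinI])
  then show ?thesis by (simp add: o_def)
qed

text \<open>
The mean value inequality on the segment from x to x - h, along which the derivative in
direction -h has order p - 1 uniformly.
\<close>

lemma order_difference:
  fixes G :: "'a::real_normed_vector \<Rightarrow> 'b::real_normed_vector"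
  assumes "symbol (Suc 0) p G"
  shows "order_at_infinity (p - 1) (\<lambda>x. G (x - h) - G x)"
proof -
  obtain K where K: "\<And>x. norm x > K \<Longrightarrow> G differentiable (at x)" using assms by auto
  have "order_at_infinity (p - 1) (\<lambda>x. frechet_derivative G (at x) (- h))" using assms by simp
  from order_shifts[OF this norm_ge_zero[of h]] obtain C L where CL: "C \<ge> 0" "L > 0"
    "\<And>x v. norm x \<ge> L \<Longrightarrow> norm v \<le> norm h \<Longrightarrow>
       norm (frechet_derivative G (at (x + v)) (- h)) \<le> C * norm x powr (p - 1)" by blast
  show ?thesis unfolding order_at_infinity_def
  proof (intro exI allI impI)
    fix x :: 'a assume x: "norm x \<ge> max L (K + norm h + 1)"
    have small: "norm (u *\<^sub>R (- h)) \<le> norm h" if "u \<in> {0..1}" for u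
      using that by (auto intro: mult_left_le_one_le)
    have "norm ((\<lambda>u. G (x + u *\<^sub>R (- h))) 1 - (\<lambda>u. G (x + u *\<^sub>R (- h))) 0) \<le> C * norm x powr (p - 1) * 1"
    proof (rule mean_value_bound)
      fix u :: real assume u: "u \<in> {0..1}"
      have "norm (x + u *\<^sub>R (- h)) \<ge> norm x - norm (u *\<^sub>R (- h))" by (rule norm_diff_ineq)
      then have "norm (x + u *\<^sub>R (- h)) > K" using x small[OF u] by linarith
      then show "((\<lambda>u. G (x + u *\<^sub>R (- h))) has_vector_derivative
          frechet_derivative G (at (x + u *\<^sub>R (- h))) (- h)) (at u)"
        by (intro has_vector_derivative_along_line K)
      show "norm (frechet_derivative G (at (x + u *\<^sub>R (- h))) (- h)) \<le> C * norm x powr (p - 1)"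
        using x small[OF u] by (intro CL) auto
    qed auto
    then show "norm (G (x - h) - G x) \<le> C * norm x powr (p - 1)" by simp
  qed
qed

text \<open>
Taking a difference commutes with taking a directional derivative, so an induction on the
number of derivatives reduces the claim to \<open>order_difference\<close>.
\<close>

lemma symbol_difference:
  fixes G :: "'a::real_normed_vector \<Rightarrow> 'b::real_normed_vector"
  assumes "symbol (Suc n) p G"
  shows "symbol n (p - 1) (\<lambda>x. G (x - h) - G x)"
  using assms
proof (induction n arbitrary: p G)
  case 0
  then show ?case using order_difference by simp
next
  case (Suc n)
  obtain K where K: "\<And>x. norm x > K \<Longrightarrow> G differentiable (at x)" using Suc.prems by auto
  define L where "L = K + norm h"
  have d: "((\<lambda>x. G (x - h) - G x) has_derivative
      (\<lambda>v. frechet_derivative G (at (x - h)) v - frechet_derivative G (at x) v)) (at x)"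
    if x: "norm x > L" for x :: 'a
  proof -
    have "norm (x - h) > K" "norm x > K"
      using x norm_triangle_ineq2[of x h] norm_ge_zero[of h] by (auto simp: L_def simp del: norm_ge_zero)
    then have g: "(G has_derivative frechet_derivative G (at x)) (at x)"
      "(G has_derivative frechet_derivative G (at (x - h))) (at (x - h))"
      using K by (auto simp: frechet_derivative_works[symmetric])
    have "((\<lambda>x. x - h) has_derivative (\<lambda>v. v)) (at x)" by (auto intro!: derivative_eq_intros)
    from diff_chain_at[OF this g(2)]
    have "((\<lambda>x. G (x - h)) has_derivative frechet_derivative G (at (x - h))) (at x)" by (simp add: o_def)
    from has_derivative_diff[OF this g(1)] show ?thesis .
  qed
  have "symbol n (p - 1 - 1) (\<lambda>x. frechet_derivative (\<lambda>x. G (x - h) - G x) (at x) v)" for v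
  proof (rule symbol_cong)
    show "symbol n (p - 1 - 1) (\<lambda>x. frechet_derivative G (at (x - h)) v - frechet_derivative G (at x) v)"
      using Suc.prems by (intro Suc.IH[of "p - 1" "\<lambda>x. frechet_derivative G (at x) v"]) simp
    show "frechet_derivative G (at (x - h)) v - frechet_derivative G (at x) v =
        frechet_derivative (\<lambda>x. G (x - h) - G x) (at x) v" if "norm x > L" for x :: 'a
      using fun_cong[OF frechet_derivative_at[OF d[OF that]]] .
  qed
  moreover have "order_at_infinity (p - 1) (\<lambda>x. G (x - h) - G x)"
    using Suc.prems by (intro order_difference) (auto intro: symbol_order)
  moreover have "\<forall>x. norm x > L \<longrightarrow> (\<lambda>x. G (x - h) - G x) differentiable (at x)"
    by (intro allI impI differentiableI[OF d])
  ultimately show ?case unfolding symbol.simps by (intro conjI exI[of _ L]) simp_all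
qed

primrec dir_deriv :: "nat \<Rightarrow> 'a \<Rightarrow> ('a::real_normed_vector \<Rightarrow> 'b::real_normed_vector) \<Rightarrow> 'a \<Rightarrow> 'b"
  where
    "dir_deriv 0 v G = G"
  | "dir_deriv (Suc i) v G = dir_deriv i v (\<lambda>x. frechet_derivative G (at x) v)"

text \<open>
The derivative in t of the \<open>N+1\<close>-st remainder of G is the \<open>N\<close>-th remainder of the directional
derivative of G, and the remainder vanishes at t = 0. The mean value inequality therefore
carries the bound from \<open>N\<close> to \<open>N+1\<close>; uniformity in t is what makes this induction work.
\<close>

lemma taylor_remainder_order:
  fixes G :: "'a::real_normed_vector \<Rightarrow> 'b::real_normed_vector"
  assumes "symbol N p G"
  obtains C K where "C \<ge> 0" "K > 0" "\<And>y t. norm y \<ge> K \<Longrightarrow> t \<in> {0..1} \<Longrightarrow>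
    norm (G (y + t *\<^sub>R v) - (\<Sum>i<N. (t ^ i / fact i) *\<^sub>R dir_deriv i v G y)) \<le> C * norm y powr (p - N)"
  using assms
proof (induction N arbitrary: p G thesis)
  case 0
  have "order_at_infinity p G" using 0 by simp
  from order_shifts[OF this norm_ge_zero[of v]] obtain C L where CL: "C \<ge> 0" "L > 0"
    "\<And>x w. norm x \<ge> L \<Longrightarrow> norm w \<le> norm v \<Longrightarrow> norm (G (x + w)) \<le> C * norm x powr p" by blast
  show ?case
    by (rule 0(1)[OF CL(1,2)]) (auto intro!: CL(3) mult_left_le_one_le)
next
  case (Suc N)
  define D where "D = (\<lambda>x. frechet_derivative G (at x) v)"
  obtain K where K: "\<And>x. norm x > K \<Longrightarrow> G differentiable (at x)" using Suc.prems(2) by auto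
  have "symbol N (p - 1) D" using Suc.prems by (simp add: D_def)
  from Suc.IH[OF _ this] obtain C L where CL: "C \<ge> 0" "L > 0"
    "\<And>y t. norm y \<ge> L \<Longrightarrow> t \<in> {0..1} \<Longrightarrow>
    norm (D (y + t *\<^sub>R v) - (\<Sum>i<N. (t ^ i / fact i) *\<^sub>R dir_deriv i v D y)) \<le> C * norm y powr (p - 1 - N)"
    by blast
  show ?case
  proof (rule Suc.prems(1)[of C "max L (K + norm v + 1)"])
    show "C \<ge> 0" "max L (K + norm v + 1) > 0" using CL by auto
    fix y :: 'a and t assume y: "norm y \<ge> max L (K + norm v + 1)" and t: "t \<in> {0..1::real}"
    define R where "R = (\<lambda>u. G (y + u *\<^sub>R v) - (\<Sum>i<Suc N. (u ^ i / fact i) *\<^sub>R dir_deriv i v G y))"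
    have R_split: "R u = G (y + u *\<^sub>R v) - (G y + (\<Sum>i<N. (u ^ Suc i / fact (Suc i)) *\<^sub>R dir_deriv i v D y))" for u
      unfolding R_def sum.lessThan_Suc_shift by (simp add: D_def)
    have "norm (R t - R 0) \<le> C * norm y powr (p - 1 - N) * t"
    proof (rule mean_value_bound)
      fix u assume "u \<in> {0..t}"
      with t have u: "u \<in> {0..1}" by auto
      have "norm (u *\<^sub>R v) \<le> norm v" using u by (auto intro: mult_left_le_one_le)
      moreover have "norm (y + u *\<^sub>R v) \<ge> norm y - norm (u *\<^sub>R v)" by (rule norm_diff_ineq)
      ultimately have "norm (y + u *\<^sub>R v) > K" using y by linarith
      then have "((\<lambda>u. G (y + u *\<^sub>R v)) has_vector_derivative D (y + u *\<^sub>R v)) (at u)"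
        unfolding D_def by (intro has_vector_derivative_along_line K)
      moreover have "((\<lambda>u. \<Sum>i<N. (u ^ Suc i / fact (Suc i)) *\<^sub>R dir_deriv i v D y) has_vector_derivative
          (\<Sum>i<N. (u ^ i / fact i) *\<^sub>R dir_deriv i v D y)) (at u)"
      proof (rule has_vector_derivative_sum)
        fix i
        have "((\<lambda>u::real. u ^ Suc i / fact (Suc i)) has_field_derivative u ^ i / fact i) (at u)"
          using DERIV_cdivide[OF DERIV_pow[of "Suc i" u], of "fact (Suc i)"]
          by (simp only: fact_Suc) (simp del: of_nat_Suc)
        from has_vector_derivative_scaleR[OF this has_vector_derivative_const]
        show "((\<lambda>u. (u ^ Suc i / fact (Suc i)) *\<^sub>R dir_deriv i v D y) has_vector_derivative
          (u ^ i / fact i) *\<^sub>R dir_deriv i v D y) (at u)" by simp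
      qed
      ultimately have "((\<lambda>u. G (y + u *\<^sub>R v) - (G y + (\<Sum>i<N. (u ^ Suc i / fact (Suc i)) *\<^sub>R dir_deriv i v D y)))
          has_vector_derivative D (y + u *\<^sub>R v) - (0 + (\<Sum>i<N. (u ^ i / fact i) *\<^sub>R dir_deriv i v D y))) (at u)"
        by (intro has_vector_derivative_diff has_vector_derivative_add has_vector_derivative_const)
      then show "(R has_vector_derivative
          D (y + u *\<^sub>R v) - (\<Sum>i<N. (u ^ i / fact i) *\<^sub>R dir_deriv i v D y)) (at u)"
        by (simp only: R_split[abs_def] add_0)
      show "norm (D (y + u *\<^sub>R v) - (\<Sum>i<N. (u ^ i / fact i) *\<^sub>R dir_deriv i v D y))
          \<le> C * norm y powr (p - 1 - N)"
        using y u by (intro CL) auto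
    qed (use t in auto)
    moreover have "R 0 = 0" by (simp add: R_split)
    moreover have "C * norm y powr (p - 1 - N) * t \<le> C * norm y powr (p - 1 - N)"
      using t CL by (intro mult_left_le) auto
    moreover have "p - 1 - N = p - Suc N" by simp
    ultimately show "norm (G (y + t *\<^sub>R v) - (\<Sum>i<Suc N. (t ^ i / fact i) *\<^sub>R dir_deriv i v G y))
        \<le> C * norm y powr (p - Suc N)"
      by (simp add: R_def)
  qed
qed

section \<open>Homogeneous functions\<close>

lemma smooth_on_dir_deriv:
  assumes "smooth_on f S"
  shows "smooth_on (\<lambda>x. frechet_derivative f (at x) v) S"
  unfolding smooth_on_def
proof
  fix n
  have "Ck_on (Suc n) f S" using assms by (simp only: smooth_on_def)
  then show "Ck_on n (\<lambda>x. frechet_derivative f (at x) v) S" by simp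
qed

lemma smooth_on_differentiable:
  assumes "smooth_on f S" "x \<in> S"
  shows "f differentiable (at x)"
proof -
  have "Ck_on (Suc 0) f S" using assms by (simp only: smooth_on_def)
  with assms(2) show ?thesis by simp
qed

lemma smooth_on_continuous: "smooth_on f S \<Longrightarrow> continuous_on S f"
  unfolding smooth_on_def using Ck_on.simps(1) by blast

text \<open>
One chain rule serves both halves of homogeneity: r = 1/t for the degree and r = -1 for the
parity.
\<close>

lemma frechet_derivative_rescaled:
  fixes f :: "'a::real_normed_vector \<Rightarrow> complex"
  assumes "\<And>y. y \<noteq> 0 \<Longrightarrow> f y = c * f (r *\<^sub>R y)" "r \<noteq> 0" "x \<noteq> 0"
    "f differentiable (at (r *\<^sub>R x))"
  shows "frechet_derivative f (at x) v = c * of_real r * frechet_derivative f (at (r *\<^sub>R x)) v"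
proof -
  define D where "D = frechet_derivative f (at (r *\<^sub>R x))"
  have D: "(f has_derivative D) (at (r *\<^sub>R x))"
    using assms(4) by (simp add: D_def frechet_derivative_works[symmetric])
  have "((\<lambda>y. r *\<^sub>R y) has_derivative (\<lambda>v. r *\<^sub>R v)) (at x)"
    by (auto intro!: derivative_eq_intros)
  from diff_chain_at[OF this D] have "((\<lambda>y. f (r *\<^sub>R y)) has_derivative (\<lambda>v. D (r *\<^sub>R v))) (at x)"
    by (simp add: o_def)
  then have "((\<lambda>y. c * f (r *\<^sub>R y)) has_derivative (\<lambda>v. c * D (r *\<^sub>R v))) (at x)"
    by (rule has_derivative_mult_right)
  then have "(f has_derivative (\<lambda>v. c * D (r *\<^sub>R v))) (at x)"
    by (rule has_derivative_transform_within_open[of _ _ _ _ "- {0}"]) (use assms(3) assms(1)[symmetric] in auto)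
  from fun_cong[OF frechet_derivative_at[OF this], of v]
  have "frechet_derivative f (at x) v = c * D (r *\<^sub>R v)" by simp
  also have "D (r *\<^sub>R v) = of_real r * D v"
    using linear_scale[OF has_derivative_linear[OF D]] by (simp add: scaleR_conv_of_real)
  finally show ?thesis by (simp add: D_def)
qed

lemma homogeneous_scale:
  "homogeneous_of_type f \<sigma> \<epsilon> \<Longrightarrow> x \<noteq> 0 \<Longrightarrow> t > 0 \<Longrightarrow> f (t *\<^sub>R x) = complex_of_real t powr \<sigma> * f x"
  unfolding homogeneous_of_type_def by blast

lemma homogeneous_neg:
  "homogeneous_of_type f \<sigma> \<epsilon> \<Longrightarrow> x \<noteq> 0 \<Longrightarrow> f (- x) = of_int \<epsilon> * f x"
  unfolding homogeneous_of_type_def by blast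

lemma homogeneous_dir_deriv:
  fixes f :: "real ^ 'k \<Rightarrow> complex"
  assumes "smooth_on f (UNIV - {0})" "homogeneous_of_type f \<sigma> \<epsilon>"
  shows "homogeneous_of_type (\<lambda>x. frechet_derivative f (at x) v) (\<sigma> - 1) (- \<epsilon>)"
proof -
  have diff: "f differentiable (at x)" if "x \<noteq> 0" for x
    using smooth_on_differentiable[OF assms(1)] that by auto
  show ?thesis unfolding homogeneous_of_type_def
  proof (intro conjI allI impI)
    fix x :: "real ^ 'k" and t :: real assume x: "x \<noteq> 0" and t: "t > 0"
    have *: "f y = complex_of_real t powr \<sigma> * f (inverse t *\<^sub>R y)" if "y \<noteq> 0" for y
    proof -
      have "f (t *\<^sub>R (inverse t *\<^sub>R y)) = complex_of_real t powr \<sigma> * f (inverse t *\<^sub>R y)"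
        using that t by (intro homogeneous_scale[OF assms(2)]) auto
      then show ?thesis using t by simp
    qed
    have "frechet_derivative f (at (t *\<^sub>R x)) v = complex_of_real t powr \<sigma> * of_real (inverse t) *
        frechet_derivative f (at (inverse t *\<^sub>R t *\<^sub>R x)) v"
      by (rule frechet_derivative_rescaled[of f _ "inverse t", OF *]) (use x t diff in auto)
    then show "frechet_derivative f (at (t *\<^sub>R x)) v = complex_of_real t powr (\<sigma> - 1) * frechet_derivative f (at x) v"
      using t by (simp add: powr_diff divide_simps)
  next
    fix x :: "real ^ 'k" assume x: "x \<noteq> 0"
    have *: "f y = of_int \<epsilon> * f (- 1 *\<^sub>R y)" if "y \<noteq> 0" for y
    proof -
      have "f (- (- y)) = of_int \<epsilon> * f (- y)"
        using that by (intro homogeneous_neg[OF assms(2)]) simp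
      then show ?thesis by simp
    qed
    have "frechet_derivative f (at (- x)) v = of_int \<epsilon> * of_real (- 1) *
        frechet_derivative f (at (- 1 *\<^sub>R (- x))) v"
      by (rule frechet_derivative_rescaled[of f _ "- 1", OF *]) (use x diff in auto)
    then show "frechet_derivative f (at (- x)) v = of_int (- \<epsilon>) * frechet_derivative f (at x) v" by simp
  qed
qed

text \<open>
The function is bounded on the compact unit sphere, hence of order Re \<sigma> by homogeneity,
and the same applies to its derivatives, which are homogeneous of degree \<sigma> - 1.
\<close>

lemma homogeneous_symbol:
  fixes f :: "real ^ 'k \<Rightarrow> complex"
  assumes "smooth_on f (UNIV - {0})" "homogeneous_of_type f \<sigma> \<epsilon>"
  shows "symbol n (Re \<sigma>) f"
proof -
  have order: "order_at_infinity (Re \<tau>) g"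
    if g: "smooth_on g (UNIV - {0})" "homogeneous_of_type g \<tau> \<eta>" for g :: "real ^ 'k \<Rightarrow> complex" and \<tau> \<eta>
  proof -
    have "continuous_on (UNIV - {0}) g" by (rule smooth_on_continuous[OF g(1)])
    then have "continuous_on (sphere 0 1) g" by (rule continuous_on_subset) auto
    then have "compact (g ` sphere 0 1)" by (intro compact_continuous_image) auto
    then obtain C where C: "\<And>y. y \<in> sphere 0 1 \<Longrightarrow> norm (g y) \<le> C"
      by (meson bounded_iff compact_imp_bounded imageI)
    show ?thesis unfolding order_at_infinity_def
    proof (intro exI allI impI)
      fix x :: "real ^ 'k" assume x: "norm x \<ge> 1"
      then have x0: "x \<noteq> 0" by auto
      have "g (norm x *\<^sub>R (inverse (norm x) *\<^sub>R x)) = complex_of_real (norm x) powr \<tau> * g (inverse (norm x) *\<^sub>R x)"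
        using x0 by (intro homogeneous_scale[OF g(2)]) auto
      then have "norm (g x) = norm x powr Re \<tau> * norm (g (inverse (norm x) *\<^sub>R x))"
        using x0 by (simp add: norm_mult norm_powr_real_powr)
      also have "\<dots> \<le> norm x powr Re \<tau> * C"
        using x0 by (intro mult_left_mono C) auto
      finally show "norm (g x) \<le> C * norm x powr Re \<tau>" by (simp add: mult.commute)
    qed
  qed
  show ?thesis using assms
  proof (induction n arbitrary: f \<sigma> \<epsilon>)
    case 0
    then show ?case using order by simp
  next
    case (Suc n)
    have "\<exists>K. \<forall>x. norm x > K \<longrightarrow> f differentiable (at x)"
      using smooth_on_differentiable[OF Suc.prems(1)] by (intro exI[of _ 0]) auto
    moreover have "symbol n (Re \<sigma> - 1) (\<lambda>x. frechet_derivative f (at x) v)" for v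
      using Suc.IH[OF smooth_on_dir_deriv[OF Suc.prems(1)] homogeneous_dir_deriv[OF Suc.prems], of v] by simp
    ultimately show ?case using order[OF Suc.prems] by auto
  qed
qed

lemma homogeneous_iterated_dir_deriv:
  fixes f :: "real ^ 'k \<Rightarrow> complex"
  assumes "smooth_on f (UNIV - {0})" "homogeneous_of_type f \<sigma> \<epsilon>"
  shows "smooth_on (dir_deriv i v f) (UNIV - {0})"
    and "homogeneous_of_type (dir_deriv i v f) (\<sigma> - of_nat i) ((- 1) ^ i * \<epsilon>)"
proof -
  have "smooth_on (dir_deriv i v f) (UNIV - {0}) \<and>
    homogeneous_of_type (dir_deriv i v f) (\<sigma> - of_nat i) ((- 1) ^ i * \<epsilon>)"
    using assms
  proof (induction i arbitrary: f \<sigma> \<epsilon>)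
    case (Suc i)
    from Suc.IH[OF smooth_on_dir_deriv[OF Suc.prems(1)] homogeneous_dir_deriv[OF Suc.prems], of v]
    show ?case by (simp add: algebra_simps)
  qed simp
  then show "smooth_on (dir_deriv i v f) (UNIV - {0})"
    and "homogeneous_of_type (dir_deriv i v f) (\<sigma> - of_nat i) ((- 1) ^ i * \<epsilon>)" by auto
qed

section \<open>Convergence of lattice sums\<close>

lemma nat_decay_summable: "summable (\<lambda>n::nat. inverse ((1 + real n)\<^sup>2))"
  using inverse_power_summable[of 2, where ?'a=real] summable_Suc_iff[of "\<lambda>n. inverse (real n ^ 2)"] by simp

lemma int_decay_bound:
  obtains S where "S > 0" "\<And>M::nat. (\<Sum>z\<in>{- int M..int M}. inverse ((1 + \<bar>real_of_int z\<bar>)\<^sup>2)) \<le> S"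
proof
  define g where "g = (\<lambda>n::nat. inverse ((1 + real n)\<^sup>2))"
  define S where "S = suminf g"
  have part: "sum g {..M} \<le> S" for M
    unfolding S_def using nat_decay_summable by (intro sum_le_suminf) (auto simp: g_def)
  have "g 0 > 0" by (simp add: g_def)
  then show "2 * S > 0" using part[of 0] by simp
  fix M :: nat
  have "(\<Sum>z\<in>{- int M..int M}. g (nat \<bar>z\<bar>)) \<le> (\<Sum>z\<in>int ` {..M} \<union> (\<lambda>n. - int n) ` {..M}. g (nat \<bar>z\<bar>))"
  proof (rule sum_mono2)
    show "{- int M..int M} \<subseteq> int ` {..M} \<union> (\<lambda>n. - int n) ` {..M}"
    proof
      fix z assume "z \<in> {- int M..int M}"
      then have "z = int (nat z) \<and> nat z \<le> M \<or> z = - int (nat (- z)) \<and> nat (- z) \<le> M" by auto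
      then show "z \<in> int ` {..M} \<union> (\<lambda>n. - int n) ` {..M}" by blast
    qed
  qed (auto simp: g_def)
  also have "\<dots> \<le> (\<Sum>z\<in>int ` {..M}. g (nat \<bar>z\<bar>)) + (\<Sum>z\<in>(\<lambda>n. - int n) ` {..M}. g (nat \<bar>z\<bar>))"
    by (subst sum_Un) (auto simp: g_def intro!: sum_nonneg)
  also have "\<dots> = sum g {..M} + sum g {..M}"
    by (subst (1 2) sum.reindex) (auto simp: inj_on_def)
  also have "\<dots> \<le> 2 * S" using part[of M] by simp
  finally show "(\<Sum>z\<in>{- int M..int M}. inverse ((1 + \<bar>real_of_int z\<bar>)\<^sup>2)) \<le> 2 * S"
    by (simp add: g_def)
qed

text \<open>
Over a box the sum of a product of functions of one coordinate each is the product of their sums.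
\<close>

lemma lattice_weight_summable:
  "(\<lambda>n::rat^'k. \<Prod>i\<in>UNIV. inverse ((1 + \<bar>real_of_rat (n $ i)\<bar>)\<^sup>2)) summable_on int_lattice"
proof -
  define e :: "('k \<Rightarrow> int) \<Rightarrow> rat ^ 'k" where "e = (\<lambda>z. \<chi> i. of_int (z i))"
  define g where "g = (\<lambda>z::int. inverse ((1 + \<bar>real_of_int z\<bar>)\<^sup>2))"
  obtain S where S: "S > 0" "\<And>M::nat. (\<Sum>z\<in>{- int M..int M}. g z) \<le> S"
    using int_decay_bound unfolding g_def by blast
  have "(\<lambda>z. \<Prod>i\<in>UNIV. g (z i)) summable_on (UNIV :: ('k \<Rightarrow> int) set)"
  proof (rule nonneg_bounded_partial_sums_imp_summable_on)
    show "eventually (\<lambda>X. (\<Sum>z\<in>X. \<Prod>i\<in>UNIV. g (z i)) \<le> S ^ CARD('k)) (finite_subsets_at_top (UNIV :: ('k \<Rightarrow> int) set))"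
    proof (rule eventually_finite_subsets_at_top_weakI)
      fix X :: "('k \<Rightarrow> int) set" assume X: "finite X"
      obtain M :: nat where M: "\<And>z i. z \<in> X \<Longrightarrow> \<bar>z i\<bar> \<le> int M"
      proof
        fix z i assume "z \<in> X"
        then have "nat \<bar>z i\<bar> \<le> Max ((\<lambda>(z, i). nat \<bar>z i\<bar>) ` (X \<times> UNIV))"
          using X by (intro Max_ge) (auto intro: image_eqI[of _ _ "(z, i)"])
        then show "\<bar>z i\<bar> \<le> int (Max ((\<lambda>(z, i). nat \<bar>z i\<bar>) ` (X \<times> UNIV)))" by linarith
      qed
      have "(\<Sum>z\<in>X. \<Prod>i\<in>UNIV. g (z i)) \<le> (\<Sum>z\<in>PiE (UNIV :: 'k set) (\<lambda>_. {- int M..int M}). \<Prod>i\<in>UNIV. g (z i))"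
      proof (rule sum_mono2)
        show "X \<subseteq> PiE UNIV (\<lambda>_. {- int M..int M})" using M by (force simp: abs_le_iff)
      qed (auto simp: g_def intro!: prod_nonneg finite_PiE)
      also have "\<dots> = (\<Prod>i\<in>(UNIV::'k set). \<Sum>z\<in>{- int M..int M}. g z)"
        by (subst prod_sum_PiE) auto
      also have "\<dots> \<le> S ^ CARD('k)"
        using S(2)[of M] by (simp add: power_mono sum_nonneg g_def)
      finally show "(\<Sum>z\<in>X. \<Prod>i\<in>UNIV. g (z i)) \<le> S ^ CARD('k)" .
    qed
  qed (auto simp: g_def intro!: prod_nonneg)
  moreover have "bij_betw e UNIV int_lattice"
  proof (rule bij_betwI')
    show "(e x = e y) = (x = y)" for x y by (auto simp: e_def vec_eq_iff)
    show "e x \<in> int_lattice" for x by (simp add: e_def int_lattice_def)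
    show "\<exists>x\<in>UNIV. y = e x" if "y \<in> int_lattice" for y
    proof (intro bexI UNIV_I)
      show "y = e (\<lambda>i. \<lfloor>y $ i\<rfloor>)" using that by (auto simp: e_def vec_eq_iff int_lattice_def)
    qed
  qed
  ultimately show ?thesis
    using summable_on_reindex_bij_betw[of e UNIV int_lattice "\<lambda>n. \<Prod>i\<in>UNIV. inverse ((1 + \<bar>real_of_rat (n $ i)\<bar>)\<^sup>2)"]
    by (simp add: e_def g_def)
qed

lemma finite_lattice_ball: "finite {n :: rat ^ 'k. n \<in> int_lattice \<and> norm (real_of_rat_vec n) \<le> K}"
proof -
  define Z where "Z = (rat_of_int ` {- \<lceil>\<bar>K\<bar>\<rceil>..\<lceil>\<bar>K\<bar>\<rceil>})"
  have "{n :: rat ^ 'k. n \<in> int_lattice \<and> norm (real_of_rat_vec n) \<le> K} \<subseteq> {n. \<forall>i. n $ i \<in> Z}"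
  proof safe
    fix n :: "rat ^ 'k" and i assume n: "n \<in> int_lattice" "norm (real_of_rat_vec n) \<le> K"
    then obtain z where z: "n $ i = rat_of_int z" by (auto simp: int_lattice_def elim: Ints_cases)
    have "\<bar>real_of_int z\<bar> \<le> norm (real_of_rat_vec n)"
      using component_le_norm_cart[of "real_of_rat_vec n" i] by (simp add: real_of_rat_vec_def z)
    also have "\<dots> \<le> \<bar>K\<bar>" using n(2) abs_ge_self order_trans by blast
    finally have "\<bar>real_of_int z\<bar> \<le> \<bar>K\<bar>" .
    then have "real_of_int \<bar>z\<bar> \<le> real_of_int \<lceil>\<bar>K\<bar>\<rceil>"
      using le_of_int_ceiling[of "\<bar>K\<bar>"] by (simp only: of_int_abs)
    then have "\<bar>z\<bar> \<le> \<lceil>\<bar>K\<bar>\<rceil>" by (simp only: of_int_le_iff)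
    then have "z \<in> {- \<lceil>\<bar>K\<bar>\<rceil>..\<lceil>\<bar>K\<bar>\<rceil>}" by (simp add: abs_le_iff)
    then show "n $ i \<in> Z" unfolding Z_def z by (rule imageI)
  qed
  moreover have "finite {n :: rat ^ 'k. \<forall>i. n $ i \<in> Z}"
  proof (rule finite_subset)
    show "{n :: rat ^ 'k. \<forall>i. n $ i \<in> Z} \<subseteq> vec_lambda ` PiE UNIV (\<lambda>_. Z)"
    proof
      fix n :: "rat ^ 'k" assume "n \<in> {n. \<forall>i. n $ i \<in> Z}"
      then show "n \<in> vec_lambda ` PiE UNIV (\<lambda>_. Z)" by (intro image_eqI[of _ _ "vec_nth n"]) auto
    qed
  qed (auto simp: Z_def intro!: finite_PiE)
  ultimately show ?thesis by (rule finite_subset)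
qed

definition on_lattice :: "(rat ^ 'k \<Rightarrow> complex) \<Rightarrow> rat ^ 'k \<Rightarrow> complex"
  where "on_lattice u n = (if n \<in> int_lattice then u n else 0)"

text \<open>
For |n| \<ge> 1 each coordinate satisfies 1 + |n_i| \<le> 2 |n|; with two powers of |n| for
each coordinate this bounds |n|^p by a multiple of the product weight of
\<open>lattice_weight_summable\<close>.
\<close>

lemma order_imp_lattice_summable:
  fixes u :: "rat ^ 'k \<Rightarrow> complex"
  assumes "\<And>n. n \<in> int_lattice \<Longrightarrow> norm (real_of_rat_vec n) \<ge> K \<Longrightarrow> norm (u n) \<le> C * norm (real_of_rat_vec n) powr p"
    and "p \<le> - 2 * real CARD('k)"
  shows "(\<lambda>n. norm (on_lattice u n)) summable_on UNIV"
proof -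
  define w :: "rat ^ 'k \<Rightarrow> real" where "w = (\<lambda>n. \<Prod>i\<in>UNIV. inverse ((1 + \<bar>real_of_rat (n $ i)\<bar>)\<^sup>2))"
  define B where "B = {n :: rat ^ 'k. n \<in> int_lattice \<and> norm (real_of_rat_vec n) \<le> max K 1}"
  have "(\<lambda>n. \<bar>C\<bar> * 4 ^ CARD('k) * w n) summable_on int_lattice"
    using lattice_weight_summable unfolding w_def by (rule summable_on_cmult_right)
  then have "(\<lambda>n. \<bar>C\<bar> * 4 ^ CARD('k) * w n) summable_on (int_lattice - B)"
    by (rule summable_on_subset_banach) auto
  then have "(\<lambda>n. norm (u n)) summable_on (int_lattice - B)"
  proof (rule summable_on_comparison_test)
    fix n :: "rat ^ 'k" assume "n \<in> int_lattice - B"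
    then have n: "n \<in> int_lattice" "norm (real_of_rat_vec n) > K" "norm (real_of_rat_vec n) > 1"
      by (auto simp: B_def)
    let ?r = "norm (real_of_rat_vec n)"
    have "norm (u n) \<le> C * ?r powr p" using assms(1) n by simp
    also have "\<dots> \<le> \<bar>C\<bar> * ?r powr (- 2 * real CARD('k))"
      using n assms(2) by (intro mult_mono powr_mono) auto
    also have "?r powr (- 2 * real CARD('k)) = inverse (?r ^ (2 * CARD('k)))"
      using powr_realpow[of ?r "2 * CARD('k)"] less_trans[OF zero_less_one n(3)] by (simp add: powr_minus)
    also have "\<dots> = (\<Prod>i\<in>(UNIV::'k set). inverse (?r\<^sup>2))" by (simp add: power_mult power_inverse)
    also have "\<dots> \<le> (\<Prod>i\<in>UNIV. 4 * inverse ((1 + \<bar>real_of_rat (n $ i)\<bar>)\<^sup>2))"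
    proof (rule prod_mono, intro conjI)
      fix i
      have "\<bar>real_of_rat (n $ i)\<bar> \<le> ?r"
        using component_le_norm_cart[of "real_of_rat_vec n" i] by (simp add: real_of_rat_vec_def)
      then have "(1 + \<bar>real_of_rat (n $ i)\<bar>)\<^sup>2 \<le> (2 * ?r)\<^sup>2" using n by (intro power_mono) auto
      then have "inverse ((2 * ?r)\<^sup>2) \<le> inverse ((1 + \<bar>real_of_rat (n $ i)\<bar>)\<^sup>2)"
        by (rule le_imp_inverse_le) (intro zero_less_power add_pos_nonneg zero_less_one abs_ge_zero)
      then show "inverse (?r\<^sup>2) \<le> 4 * inverse ((1 + \<bar>real_of_rat (n $ i)\<bar>)\<^sup>2)" by (simp add: power_mult_distrib)
    qed auto
    also have "\<dots> = 4 ^ CARD('k) * w n" by (simp add: prod.distrib w_def)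
    finally show "norm (u n) \<le> \<bar>C\<bar> * 4 ^ CARD('k) * w n" by (simp add: mult_left_mono mult.assoc)
  qed auto
  moreover have "(\<lambda>n. norm (u n)) summable_on B"
    unfolding B_def by (intro summable_on_finite finite_lattice_ball)
  ultimately have "(\<lambda>n. norm (u n)) summable_on (int_lattice - B) \<union> B"
    by (intro summable_on_Un_disjoint) auto
  also have "(int_lattice - B) \<union> B = int_lattice" by (auto simp: B_def)
  finally show ?thesis
    by (subst summable_on_cong_neutral[where T = int_lattice]) (auto simp: on_lattice_def)
qed

section \<open>The spaces of t-summable and h-summable functions\<close>

definition shifts :: "(rat ^ 'k \<Rightarrow> rat ^ 'k) set"
  where "shifts = (\<lambda>h x. x - h) ` UNIV"

definition dilations :: "(rat ^ 'k \<Rightarrow> rat ^ 'k) set"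
  where "dilations = (\<lambda>t x. inverse t *s x) ` (UNIV - {0})"

definition abs_summable_functions :: "('x \<Rightarrow> complex) set"
  where "abs_summable_functions = {a. (\<lambda>x. norm (a x)) summable_on UNIV}"

abbreviation t_space :: "(rat ^ 'k \<Rightarrow> complex) set"
  where "t_space \<equiv> averaged shifts abs_summable_functions"

abbreviation h_space :: "(rat ^ 'k \<Rightarrow> complex) set"
  where "h_space \<equiv> averaged dilations t_space"

lemma t_space_t_summable:
  fixes a :: "rat ^ 'k \<Rightarrow> complex"
  assumes "a \<in> t_space"
  shows "t_summable a"
proof -
  obtain z T where T: "map_comb shifts z T" "z \<noteq> 0" "T a \<in> abs_summable_functions"
    using assms by (auto simp: averaged_def)
  from map_comb_coefficients[OF T(1)[unfolded shifts_def]]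
  obtain c where c: "finite (supp c)" "(\<Sum>g\<in>supp c. c g) = z" "\<And>a x. T a x = (\<Sum>g\<in>supp c. c g * a (x - g))"
    by metis
  have "T a = conv c a" by (intro ext) (simp add: c conv_def)
  then show ?thesis using T c by (auto simp: t_summable_def abs_summable_functions_def)
qed

lemma h_space_h_summable:
  fixes a :: "rat ^ 'k \<Rightarrow> complex"
  assumes "a \<in> h_space"
  shows "h_summable a"
proof -
  obtain z T where T: "map_comb dilations z T" "z \<noteq> 0" "T a \<in> t_space"
    using assms by (auto simp: averaged_def)
  from map_comb_coefficients[OF T(1)[unfolded dilations_def]]
  obtain c where c: "finite (supp c)" "supp c \<subseteq> UNIV - {0}" "(\<Sum>g\<in>supp c. c g) = z"
    "\<And>a x. T a x = (\<Sum>t\<in>supp c. c t * a (inverse t *s x))"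
    by metis
  have "T a = (\<lambda>x. \<Sum>t\<in>supp c. c t * rho t a x)" by (intro ext) (simp add: c rho_def)
  then have "t_summable (\<lambda>x. \<Sum>t\<in>supp c. c t * rho t a x)" using t_space_t_summable[OF T(3)] by simp
  moreover have "c 0 = 0" using c(2) by (auto simp: supp_def)
  ultimately show ?thesis using T c unfolding h_summable_def by (intro exI[of _ c]) simp
qed

lemma abs_summable_functions_bij:
  assumes "a \<in> abs_summable_functions" "bij \<psi>"
  shows "(\<lambda>x. a (\<psi> x)) \<in> abs_summable_functions"
  using summable_on_reindex_bij_betw[OF assms(2), of "\<lambda>x. norm (a x)"] assms(1)
  by (simp add: abs_summable_functions_def)

lemma abs_summable_functions_add:
  assumes "a \<in> abs_summable_functions" "b \<in> abs_summable_functions"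
  shows "(\<lambda>x. a x + b x) \<in> abs_summable_functions"
proof -
  have "(\<lambda>x. norm (a x) + norm (b x)) summable_on UNIV"
    using assms by (intro summable_on_add) (auto simp: abs_summable_functions_def)
  then show ?thesis unfolding abs_summable_functions_def mem_Collect_eq
    by (rule summable_on_comparison_test) (auto intro: norm_triangle_ineq)
qed

lemma abs_summable_functions_bounded_mult:
  assumes "a \<in> abs_summable_functions" "\<And>x. norm (c x) \<le> B"
  shows "(\<lambda>x. c x * a x) \<in> abs_summable_functions"
proof -
  have "(\<lambda>x. B * norm (a x)) summable_on UNIV"
    using assms by (intro summable_on_cmult_right) (auto simp: abs_summable_functions_def)
  then show ?thesis unfolding abs_summable_functions_def mem_Collect_eq
    by (rule summable_on_comparison_test) (auto simp: norm_mult intro!: mult_right_mono assms)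
qed

lemma zero_abs_summable: "(\<lambda>x. 0) \<in> abs_summable_functions"
  by (simp add: abs_summable_functions_def)

lemma invariant_space_shifts:
  "invariant_space shifts (abs_summable_functions :: (rat ^ 'k \<Rightarrow> complex) set)"
proof
  show "(\<lambda>x. x) \<in> (shifts :: (rat ^ 'k \<Rightarrow> rat ^ 'k) set)"
    unfolding shifts_def by (rule image_eqI[of _ _ 0]) auto
  fix \<theta> \<eta> :: "rat ^ 'k \<Rightarrow> rat ^ 'k" assume "\<theta> \<in> shifts" "\<eta> \<in> shifts"
  then obtain g h where *: "\<theta> = (\<lambda>x. x - g)" "\<eta> = (\<lambda>x. x - h)" by (auto simp: shifts_def)
  show "(\<lambda>x. \<theta> (\<eta> x)) \<in> shifts"
    unfolding shifts_def * by (rule image_eqI[of _ _ "g + h"]) auto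
  show "\<theta> (\<eta> x) = \<eta> (\<theta> x)" for x by (simp add: *)
next
  fix \<theta> :: "rat ^ 'k \<Rightarrow> rat ^ 'k" and a :: "rat ^ 'k \<Rightarrow> complex"
  assume \<theta>: "\<theta> \<in> shifts" and a: "a \<in> abs_summable_functions"
  obtain h where h: "\<theta> = (\<lambda>x. x - h)" using \<theta> by (auto simp: shifts_def)
  have "bij \<theta>" unfolding h by (rule bij_betw_byWitness[of _ "\<lambda>x. x + h"]) auto
  then show "(\<lambda>x. a (\<theta> x)) \<in> abs_summable_functions" by (rule abs_summable_functions_bij[OF a])
qed (auto intro: abs_summable_functions_add abs_summable_functions_bounded_mult
       simp: zero_abs_summable)

interpretation T: invariant_space shifts "abs_summable_functions :: (rat ^ 'k \<Rightarrow> complex) set"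
  by (rule invariant_space_shifts)

text \<open>
A dilation \<open>\<theta>\<close> preserves t-summability because it turns the translation by \<open>h\<close> into the
translation by \<open>t *s h\<close>.
\<close>

lemma invariant_space_dilations:
  "invariant_space dilations (t_space :: (rat ^ 'k \<Rightarrow> complex) set)"
proof
  show "(\<lambda>x. x) \<in> (dilations :: (rat ^ 'k \<Rightarrow> rat ^ 'k) set)"
    unfolding dilations_def by (rule image_eqI[of _ _ 1]) auto
  fix \<theta> \<eta> :: "rat ^ 'k \<Rightarrow> rat ^ 'k" assume "\<theta> \<in> dilations" "\<eta> \<in> dilations"
  then obtain t u where *: "\<theta> = (\<lambda>x. inverse t *s x)" "\<eta> = (\<lambda>x. inverse u *s x)" "t \<noteq> 0" "u \<noteq> 0"
    by (auto simp: dilations_def)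
  show "(\<lambda>x. \<theta> (\<eta> x)) \<in> dilations"
    unfolding dilations_def * by (rule image_eqI[of _ _ "t * u"]) (use * in \<open>auto simp: vec_eq_iff\<close>)
  show "\<theta> (\<eta> x) = \<eta> (\<theta> x)" for x by (simp add: * vec_eq_iff mult.left_commute)
next
  fix \<theta> :: "rat ^ 'k \<Rightarrow> rat ^ 'k" and a :: "rat ^ 'k \<Rightarrow> complex"
  assume \<theta>: "\<theta> \<in> dilations" and a: "a \<in> t_space"
  obtain t where t: "\<theta> = (\<lambda>x. inverse t *s x)" "t \<noteq> 0" using \<theta> by (auto simp: dilations_def)
  have bij: "bij \<theta>" unfolding t(1)
    by (rule bij_betw_byWitness[of _ "\<lambda>x. t *s x"]) (use t in \<open>auto simp: vec_eq_iff\<close>)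
  show "(\<lambda>x. a (\<theta> x)) \<in> t_space"
  proof (rule T.averaged_map[OF a])
    show "(\<lambda>x. b (\<theta> x)) \<in> abs_summable_functions" if "b \<in> abs_summable_functions" for b :: "rat ^ 'k \<Rightarrow> complex"
      by (rule abs_summable_functions_bij[OF that bij])
    fix \<eta> :: "rat ^ 'k \<Rightarrow> rat ^ 'k" assume "\<eta> \<in> shifts"
    then obtain h where h: "\<eta> = (\<lambda>x. x - h)" by (auto simp: shifts_def)
    have "\<eta> (\<theta> x) = \<theta> (x - t *s h)" for x using t by (simp add: h vec_eq_iff field_simps)
    then show "\<exists>\<eta>'\<in>shifts. \<forall>x. \<eta> (\<theta> x) = \<theta> (\<eta>' x)" 
      unfolding shifts_def by (intro bexI[of _ "\<lambda>x. x - t *s h"]) auto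
  qed
next
  show "(\<lambda>x. 0) \<in> (t_space :: (rat ^ 'k \<Rightarrow> complex) set)"
    using T.averaged_superset T.zero_mem by blast
qed (auto intro: T.averaged_add T.averaged_scale)

interpretation H: invariant_space dilations "t_space :: (rat ^ 'k \<Rightarrow> complex) set"
  by (rule invariant_space_dilations)

lemma abs_summable_h_space: "a \<in> abs_summable_functions \<Longrightarrow> a \<in> h_space"
  using T.averaged_superset H.averaged_superset by blast


section \<open>Oscillating lattice functions\<close>

lemma int_lattice_diff: "x \<in> int_lattice \<Longrightarrow> y \<in> int_lattice \<Longrightarrow> x - y \<in> int_lattice"
  by (simp add: int_lattice_def)

lemma int_lattice_add: "x \<in> int_lattice \<Longrightarrow> y \<in> int_lattice \<Longrightarrow> x + y \<in> int_lattice"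
  by (simp add: int_lattice_def)

lemma int_lattice_diff_iff: 
  assumes "h \<in> int_lattice" shows "x - h \<in> int_lattice \<longleftrightarrow> x \<in> int_lattice"
  using int_lattice_add[of "x - h" h] int_lattice_diff[of x h] assms by auto

primrec summable_differences :: "nat \<Rightarrow> (rat ^ 'k \<Rightarrow> complex) \<Rightarrow> bool"
  where
    "summable_differences 0 G \<longleftrightarrow> on_lattice G \<in> abs_summable_functions"
  | "summable_differences (Suc n) G \<longleftrightarrow>
       (\<forall>h\<in>int_lattice. summable_differences n (\<lambda>x. G (x - h) - G x))"

text \<open>
As the sums of \<phi> over J vanish, summing \<phi> G over its translates by J gives
\<Sum>_{j \<in> J} \<phi>(x - j) (G(x - j) - G(x)). The translates \<phi>(x - j) inherit the
vanishing, so this is a sum of instances with one difference less left to take.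
\<close>

lemma oscillating_t_space:
  fixes G \<phi> :: "rat ^ 'k \<Rightarrow> complex"
  assumes "summable_differences n G" "\<And>x. norm (\<phi> x) \<le> B"
    and J: "finite J" "J \<noteq> {}" "J \<subseteq> int_lattice"
    and mean: "\<And>x. x \<in> int_lattice \<Longrightarrow> (\<Sum>j\<in>J. \<phi> (x - j)) = 0"
  shows "on_lattice (\<lambda>x. \<phi> x * G x) \<in> t_space"
  using assms(1,2) mean
proof (induction n arbitrary: G \<phi>)
  case 0
  have "(\<lambda>x. \<phi> x * on_lattice G x) \<in> abs_summable_functions"
    using 0 by (intro abs_summable_functions_bounded_mult) auto
  moreover have "(\<lambda>x. \<phi> x * on_lattice G x) = on_lattice (\<lambda>x. \<phi> x * G x)"
    by (auto simp: on_lattice_def)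
  ultimately show ?case using T.averaged_superset by auto
next
  case (Suc n)
  define E where "E = (\<lambda>a x. \<Sum>j\<in>J. 1 * (a (x - j) :: complex))"
  have "map_comb shifts (\<Sum>j\<in>J. 1) E"
    unfolding E_def by (rule map_comb_sum) (use J in \<open>auto simp: shifts_def\<close>)
  moreover have "(\<Sum>j\<in>J. 1) \<noteq> (0 :: complex)" using J by simp
  moreover have "E (on_lattice (\<lambda>x. \<phi> x * G x)) \<in> t_space"
  proof -
    have "(\<lambda>x. \<Sum>j\<in>J. on_lattice (\<lambda>x. \<phi> (x - j) * (G (x - j) - G x)) x) \<in> t_space"
    proof (rule T.averaged_sum[OF J(1)])
      fix j assume j: "j \<in> J"
      with J have jl: "j \<in> int_lattice" by auto
      show "on_lattice (\<lambda>x. \<phi> (x - j) * (G (x - j) - G x)) \<in> t_space"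
      proof (rule Suc.IH)
        show "summable_differences n (\<lambda>x. G (x - j) - G x)" using Suc.prems(1) jl by simp
        show "norm (\<phi> (x - j)) \<le> B" for x by (rule Suc.prems(2))
        fix x :: "rat ^ 'k" assume "x \<in> int_lattice"
        then have "(\<Sum>i\<in>J. \<phi> (x - j - i)) = 0" using jl by (intro Suc.prems(3) int_lattice_diff)
        moreover have "x - i - j = x - j - i" for i by (simp add: algebra_simps)
        ultimately show "(\<Sum>i\<in>J. \<phi> (x - i - j)) = 0" by (simp only:)
      qed
    qed
    moreover have "(\<Sum>j\<in>J. on_lattice (\<lambda>x. \<phi> (x - j) * (G (x - j) - G x)) x) = E (on_lattice (\<lambda>x. \<phi> x * G x)) x" for x
    proof (cases "x \<in> int_lattice")
      case True
      have "(\<Sum>j\<in>J. on_lattice (\<lambda>x. \<phi> (x - j) * (G (x - j) - G x)) x) =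
          (\<Sum>j\<in>J. \<phi> (x - j) * G (x - j)) - (\<Sum>j\<in>J. \<phi> (x - j)) * G x"
        using True by (simp add: on_lattice_def algebra_simps sum_subtractf sum_distrib_left)
      also have "\<dots> = (\<Sum>j\<in>J. \<phi> (x - j) * G (x - j))" using Suc.prems(3)[OF True] by simp
      also have "\<dots> = E (on_lattice (\<lambda>x. \<phi> x * G x)) x"
        unfolding E_def using True J by (intro sum.cong) (auto simp: on_lattice_def int_lattice_diff)
      finally show ?thesis .
    next
      case False
      then show ?thesis unfolding E_def using J
        by (intro sum.cong) (auto simp: on_lattice_def int_lattice_diff_iff subset_iff)
    qed
    ultimately show ?thesis by (simp flip: fun_eq_iff)
  qed
  ultimately show ?case by (rule T.averaged_saturated)
qed

lemma real_of_rat_vec_diff: "real_of_rat_vec (x - y) = real_of_rat_vec x - real_of_rat_vec y"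
  by (simp add: real_of_rat_vec_def vec_eq_iff of_rat_diff)

lemma real_of_rat_vec_scale: "real_of_rat_vec (c *s x) = of_rat c *\<^sub>R real_of_rat_vec x"
  by (simp add: real_of_rat_vec_def vec_eq_iff of_rat_mult)

lemma real_of_rat_vec_eq_0_iff [simp]: "real_of_rat_vec x = 0 \<longleftrightarrow> x = 0"
  by (simp add: real_of_rat_vec_def vec_eq_iff)

lemma symbol_summable_differences:
  fixes G :: "real ^ 'k \<Rightarrow> complex"
  assumes "symbol n p G" "p - n \<le> - 2 * real CARD('k)"
  shows "summable_differences n (\<lambda>x. G (real_of_rat_vec x))"
  using assms
proof (induction n arbitrary: p G)
  case 0
  then obtain C K where "\<And>x. norm x \<ge> K \<Longrightarrow> norm (G x) \<le> C * norm x powr p"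
    by (auto simp: order_at_infinity_def)
  then show ?case using 0(2)
    by (auto simp: abs_summable_functions_def intro!: order_imp_lattice_summable[of K _ C p])
next
  case (Suc n)
  have "summable_differences n (\<lambda>x. G (real_of_rat_vec x - real_of_rat_vec h) - G (real_of_rat_vec x))" for h
    by (rule Suc.IH[OF symbol_difference[OF Suc.prems(1)]]) (use Suc.prems(2) in simp)
  then show ?case by (simp add: real_of_rat_vec_diff)
qed

section \<open>Residues and dilations of the lattice\<close>

text \<open>
If m^z = 1 for all m, then also ((n+1)/n)^z = 1. For large n the exponent
z ln (1 + 1/n) is too small to be a nonzero multiple of 2 \<pi> i.
\<close>

lemma exists_nat_powr_neq_1:
  fixes z :: complex
  assumes "z \<noteq> 0"
  shows "\<exists>m::nat. m > 0 \<and> of_nat m powr z \<noteq> 1"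
proof (rule ccontr)
  assume "\<not> ?thesis"
  then have *: "of_nat m powr z = 1" if "m > 0" for m :: nat using that by blast
  obtain n :: nat where n: "real n > norm z" using reals_Archimedean2 by blast
  then have n0: "n > 0" by (metis norm_ge_zero not_less of_nat_0 neq0_conv order.strict_trans1 less_irrefl)
  define w where "w = z * of_real (ln (1 + 1 / real n))"
  have pos: "ln (1 + 1 / real n) > 0" using n0 by (intro ln_gt_zero) simp
  have "ln (real (Suc n)) - ln (real n) = ln (1 + 1 / real n)"
  proof -
    have "1 + 1 / real n = real (Suc n) / real n" using n0 by (simp add: field_simps)
    then show ?thesis using n0 ln_div[of "real (Suc n)" "real n"] by (simp del: of_nat_Suc)
  qed
  then have "exp w = of_nat (Suc n) powr z / of_nat n powr z"
    using n0 by (simp add: w_def powr_def exp_diff[symmetric] Ln_of_nat algebra_simps del: of_nat_Suc flip: of_real_diff)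
  then have "exp w = 1" using *[of n] *[of "Suc n"] n0 by simp
  then obtain j :: int where j: "Re w = 0" "Im w = of_int (2 * j) * pi" by (auto simp: exp_eq_1)
  have "norm w = norm z * ln (1 + 1 / real n)" using pos by (simp add: w_def norm_mult)
  also have "\<dots> \<le> real n * (1 / real n)"
    using n pos ln_add_one_self_le_self[of "1 / real n"] by (intro mult_mono) auto
  finally have "norm w \<le> 1" using n0 by simp
  then have "\<bar>of_int (2 * j) * pi\<bar> \<le> 1" using abs_Im_le_cmod[of w] j by linarith
  then have "\<bar>real_of_int (2 * j)\<bar> * pi \<le> 1" by (simp add: abs_mult)
  moreover have "\<bar>real_of_int (2 * j)\<bar> * pi > 1" if "j \<noteq> 0"
  proof -
    have "1 < 1 * pi" using pi_gt3 by simp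
    also have "\<dots> \<le> \<bar>real_of_int (2 * j)\<bar> * pi" using that by (intro mult_right_mono) auto
    finally show ?thesis .
  qed
  ultimately have "j = 0" by force
  then have "w = 0" using j by (simp add: complex_eq_iff)
  then show False using assms pos by (simp add: w_def)
qed

lemma residue_box:
  assumes "m > 0"
  obtains J :: "(rat ^ 'k) set" where "finite J" "J \<noteq> {}" "J \<subseteq> int_lattice" "card J = m ^ CARD('k)"
    "\<And>x. x \<in> int_lattice \<Longrightarrow> \<exists>!j. j \<in> J \<and> inverse (of_nat m) *s (x - j) \<in> int_lattice"
proof
  define P where "P = PiE (UNIV :: 'k set) (\<lambda>_. rat_of_nat ` {..<m})"
  define J :: "(rat ^ 'k) set" where "J = vec_lambda ` P"
  have fin: "finite P" unfolding P_def by (intro finite_PiE) auto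
  have J_iff: "j \<in> J \<longleftrightarrow> (\<forall>i. j $ i \<in> rat_of_nat ` {..<m})" for j
  proof
    assume "\<forall>i. j $ i \<in> rat_of_nat ` {..<m}"
    then show "j \<in> J" unfolding J_def P_def by (intro image_eqI[of _ _ "vec_nth j"]) auto
  next
    assume "j \<in> J"
    then obtain g where g: "g \<in> P" "j = vec_lambda g" unfolding J_def by blast
    show "\<forall>i. j $ i \<in> rat_of_nat ` {..<m}"
      using PiE_mem[OF g(1)[unfolded P_def] UNIV_I] by (simp add: g(2) del: image_iff)
  qed
  show "finite J" using fin by (simp add: J_def)
  have "0 \<in> J" using assms by (auto simp: J_iff intro!: image_eqI[of _ _ 0])
  then show "J \<noteq> {}" by blast
  show "J \<subseteq> int_lattice"
  proof
    fix j assume "j \<in> J"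
    then have "j $ i \<in> \<int>" for i using J_iff[of j] by (auto simp: image_iff dest: spec[of _ i])
    then show "j \<in> int_lattice" by (simp add: int_lattice_def)
  qed
  have "card J = card P" unfolding J_def by (intro card_image) (auto simp: inj_on_def vec_lambda_inject)
  also have "\<dots> = m ^ CARD('k)" by (simp add: P_def card_PiE card_image inj_on_def)
  finally show "card J = m ^ CARD('k)" .
  fix x :: "rat ^ 'k" assume "x \<in> int_lattice"
  then obtain z where z: "\<And>i. x $ i = of_int (z i)" 
    using that[of "\<lambda>i. \<lfloor>x $ i\<rfloor>"] by (simp add: int_lattice_def)
  have div_iff: "inverse (of_nat m) * (of_int a - of_nat b) \<in> (\<int> :: rat set) \<longleftrightarrow> int b mod int m = a mod int m"
    for a :: int and b :: nat
  proof
    assume "inverse (of_nat m) * (of_int a - of_nat b) \<in> (\<int> :: rat set)"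
    then obtain c :: int where "inverse (of_nat m) * (of_int a - of_nat b) = (of_int c :: rat)" by (auto elim: Ints_cases)
    then have "of_int (a - int b) = (of_int (int m * c) :: rat)" using assms by (simp add: field_simps)
    then have "a - int b = int m * c" by (simp only: of_int_eq_iff)
    then have "a mod int m = int b mod int m" unfolding mod_eq_dvd_iff by simp
    then show "int b mod int m = a mod int m" by (rule sym)
  next
    assume "int b mod int m = a mod int m"
    from this[symmetric] obtain c where "a - int b = int m * c" unfolding mod_eq_dvd_iff by (rule dvdE)
    then have "of_int (a - int b) = (of_int (int m * c) :: rat)" by simp
    then have "inverse (of_nat m) * (of_int a - of_nat b) = (of_int c :: rat)" using assms by (simp add: field_simps)
    then show "inverse (of_nat m) * (of_int a - of_nat b) \<in> (\<int> :: rat set)" by simp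
  qed
  show "\<exists>!j. j \<in> J \<and> inverse (of_nat m) *s (x - j) \<in> int_lattice"
  proof (rule ex1I, intro conjI)
    define j0 :: "rat ^ 'k" where "j0 = (\<chi> i. of_nat (nat (z i mod int m)))"
    have "nat (z i mod int m) < m" for i using assms by (simp add: nat_less_iff)
    then show "j0 \<in> J" unfolding J_iff j0_def vec_lambda_beta by blast
    show "inverse (of_nat m) *s (x - j0) \<in> int_lattice"
      using assms div_iff[of "z i" "nat (z i mod int m)" for i] by (simp add: int_lattice_def z j0_def del: vector_ssub_ldistrib)
    fix j assume j: "j \<in> J \<and> inverse (of_nat m) *s (x - j) \<in> int_lattice"
    show "j = j0"
    proof (subst vec_eq_iff, rule allI)
      fix i
      obtain b where b: "j $ i = of_nat b" "b < m" using j by (auto simp: J_iff)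
      have "(inverse (of_nat m) *s (x - j)) $ i \<in> \<int>" using j unfolding int_lattice_def by blast
      then have "inverse (of_nat m) * (of_int (z i) - of_nat b) \<in> (\<int> :: rat set)"
        by (simp only: vector_smult_component vector_minus_component z b)
      then have "int b mod int m = z i mod int m" by (rule div_iff[THEN iffD1])
      then have "int b = z i mod int m" using b(2) by simp
      then show "j $ i = j0 $ i" using b by (simp add: j0_def flip: \<open>int b = z i mod int m\<close>)
    qed
  qed
qed

lemma int_lattice_scale: "x \<in> int_lattice \<Longrightarrow> of_nat m *s x \<in> int_lattice"
  by (simp add: int_lattice_def)

lemma finite_support_abs_summable:
  "finite A \<Longrightarrow> (\<lambda>x. if x \<in> A then a x else 0) \<in> abs_summable_functions"
  unfolding abs_summable_functions_def mem_Collect_eq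
  by (rule finite_nonzero_values_imp_summable_on) (auto intro: finite_subset[of _ A])


section \<open>Summability of homogeneous functions\<close>

definition restriction :: "(real ^ 'k \<Rightarrow> complex) \<Rightarrow> rat ^ 'k \<Rightarrow> complex"
  where "restriction f n = (if n \<in> int_lattice - {0} then f (real_of_rat_vec n) else 0)"

text \<open>
For even f, homogeneity gives m^{k-s} f(x/m) = m^k f(x), so dilation by m with weight -m^{k-s}
turns f into f times a function that cancels on average over residues modulo m. The origin
is corrected separately because the value of f there is arbitrary.
\<close>

lemma homogeneous_h_space:
  fixes f :: "real ^ 'k \<Rightarrow> complex"
  assumes smooth: "smooth_on f (UNIV - {0})" and hom: "homogeneous_of_type f (- s) \<epsilon>"
    and "\<epsilon> \<in> {1, - 1}" and neq: "(s, \<epsilon>) \<noteq> (of_nat CARD('k), 1)"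
  shows "restriction f \<in> h_space"
proof (cases "\<epsilon> = 1")
  case False
  with assms(3) have eps: "\<epsilon> = - 1" by simp
  define R where "R = (\<lambda>(a :: rat ^ 'k \<Rightarrow> complex) x. \<Sum>t\<in>{1, - 1}. 1 * a (inverse t *s x))"
  have "map_comb dilations (\<Sum>t\<in>{1, - 1 :: rat}. 1) R"
    unfolding R_def by (rule map_comb_sum) (auto simp: dilations_def)
  moreover have "(\<Sum>t\<in>{1, - 1 :: rat}. 1) \<noteq> (0 :: complex)" by simp
  moreover have "R (restriction f) = (\<lambda>x. 0)"
  proof
    fix x :: "rat ^ 'k"
    have "- 1 *s x = - x" by (simp add: vec_eq_iff)
    moreover have "real_of_rat_vec (- x) = - real_of_rat_vec x"
      by (simp add: real_of_rat_vec_def vec_eq_iff of_rat_minus)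
    moreover have "- x \<in> int_lattice \<longleftrightarrow> x \<in> int_lattice" by (simp add: int_lattice_def)
    ultimately show "R (restriction f) x = 0"
      using homogeneous_neg[OF hom, of "real_of_rat_vec x"] by (auto simp: R_def restriction_def eps)
  qed
  then have "R (restriction f) \<in> t_space" using H.zero_mem by simp
  ultimately show ?thesis by (rule averagedI)
next
  case True
  define k where "k = CARD('k)"
  have "of_nat k - s \<noteq> 0" using True neq by (auto simp: k_def)
  then obtain m :: nat where m: "m > 0" "of_nat m powr (of_nat k - s) \<noteq> 1"
    using exists_nat_powr_neq_1 by blast
  define w :: complex where "w = - (of_nat m powr (of_nat k - s))"
  define R where "R = (\<lambda>a x. w * a (inverse (of_nat m) *s x) + 1 * (a :: rat ^ 'k \<Rightarrow> complex) (inverse 1 *s x))"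
  have R: "map_comb dilations (w + 1) R"
    unfolding R_def
  proof (intro map_comb.add map_comb_single)
    show "(\<lambda>x. inverse (of_nat m) *s x) \<in> dilations"
      unfolding dilations_def by (rule image_eqI[of _ _ "of_nat m"]) (use m in auto)
    show "(\<lambda>x. inverse 1 *s x) \<in> dilations"
      unfolding dilations_def by (rule image_eqI[of _ _ 1]) auto
  qed
  obtain J :: "(rat ^ 'k) set" where J: "finite J" "J \<noteq> {}" "J \<subseteq> int_lattice" "card J = m ^ k"
    "\<And>x. x \<in> int_lattice \<Longrightarrow> \<exists>!j. j \<in> J \<and> inverse (of_nat m) *s (x - j) \<in> int_lattice"
    using residue_box[OF m(1)] unfolding k_def by blast
  \<comment> \<open>The density \<open>1\<close> of the lattice minus the density \<open>m ^ k\<close> put on its multiples of \<open>m\<close>.\<close>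
  define \<phi> :: "rat ^ 'k \<Rightarrow> complex"
    where "\<phi> = (\<lambda>x. 1 - of_nat m ^ k * (if inverse (of_nat m) *s x \<in> int_lattice then 1 else 0))"
  define F where "F = (\<lambda>x. f (real_of_rat_vec x))"
  define N where "N = nat \<lceil>Re (- s) + 2 * real k\<rceil>"
  have "symbol N (Re (- s)) f" by (rule homogeneous_symbol[OF smooth hom])
  then have "summable_differences N F"
    unfolding F_def by (rule symbol_summable_differences) (use real_nat_ceiling_ge[of "Re (- s) + 2 * real k"] in \<open>simp add: N_def k_def\<close>)
  then have "on_lattice (\<lambda>x. \<phi> x * F x) \<in> t_space"
  proof (rule oscillating_t_space[OF _ _ J(1,2,3)])
    show "norm (\<phi> x) \<le> 1 + of_nat m ^ k" for x
      unfolding \<phi>_def by (rule order_trans[OF norm_triangle_ineq4]) (auto simp: norm_mult norm_power)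
    fix x :: "rat ^ 'k" assume "x \<in> int_lattice"
    from J(5)[OF this] obtain j0 where j0: "{j \<in> J. inverse (of_nat m) *s (x - j) \<in> int_lattice} = {j0}"
      by auto
    have "(\<Sum>j\<in>J. \<phi> (x - j)) = of_nat (card J) - of_nat m ^ k * (\<Sum>j\<in>J. if inverse (of_nat m) *s (x - j) \<in> int_lattice then 1 else 0)"
      by (simp add: \<phi>_def sum_subtractf sum_distrib_left)
    also have "(\<Sum>j\<in>J. if inverse (of_nat m) *s (x - j) \<in> int_lattice then 1 else (0::complex)) = 1"
      unfolding sum.inter_filter[OF J(1), symmetric] j0 by simp
    finally show "(\<Sum>j\<in>J. \<phi> (x - j)) = 0" using J(4) by simp
  qed
  \<comment> \<open>At \<open>0\<close> the product \<open>\<phi> x * F x\<close> involves the meaningless value \<open>f 0\<close>; this term removes it.\<close>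
  moreover have "(\<lambda>x. if x \<in> {0} then - (\<phi> x * F x) else 0) \<in> t_space"
    using finite_support_abs_summable[of "{0}" "\<lambda>x. - (\<phi> x * F x)"] T.averaged_superset by blast
  ultimately have sum: "(\<lambda>x. on_lattice (\<lambda>x. \<phi> x * F x) x + (if x \<in> {0} then - (\<phi> x * F x) else 0)) \<in> t_space"
    by (rule T.averaged_add)
  have pointwise: "R (restriction f) x = on_lattice (\<lambda>x. \<phi> x * F x) x + (if x \<in> {0} then - (\<phi> x * F x) else 0)" for x
  proof (cases "x = 0")
    case True
    then show ?thesis by (simp add: R_def restriction_def on_lattice_def int_lattice_def)
  next
    case False
    let ?y = "inverse (of_nat m) *s x"
    have y: "?y \<noteq> 0" using False m by (simp add: vec_eq_iff)
    have rescale: "of_nat m *s ?y = x" using m by (simp add: vec_eq_iff)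
    have lat: "x \<in> int_lattice" if "?y \<in> int_lattice"
    proof -
      have "of_nat m *s ?y \<in> int_lattice" by (rule int_lattice_scale[OF that])
      then show ?thesis unfolding rescale .
    qed
    have scaled: "f (real_of_rat_vec ?y) = of_nat m powr s * F x"
    proof -
      have "F x = f (real m *\<^sub>R real_of_rat_vec ?y)"
        using m by (simp add: F_def real_of_rat_vec_scale of_rat_inverse)
      also have "\<dots> = of_nat m powr (- s) * f (real_of_rat_vec ?y)"
        using homogeneous_scale[OF hom, of "real_of_rat_vec ?y" "real m"] y m by simp
      finally show ?thesis using m by (simp add: powr_minus)
    qed
    have weight: "of_nat m powr (of_nat k - s) * of_nat m powr s = (of_nat m ^ k :: complex)"
      using m by (simp add: powr_diff powr_nat')
    have "w * f (real_of_rat_vec ?y) = - (of_nat m powr (of_nat k - s) * of_nat m powr s) * F x"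
      unfolding w_def scaled by (simp only: mult_minus_left mult.assoc)
    then have main_eq: "w * f (real_of_rat_vec ?y) = - (of_nat m ^ k) * F x" unfolding weight .
    show ?thesis
    proof (cases "?y \<in> int_lattice")
      case True
      have "R (restriction f) x = w * f (real_of_rat_vec ?y) + F x"
        using True False y lat by (simp add: R_def restriction_def F_def)
      also have "\<dots> = \<phi> x * F x" unfolding main_eq \<phi>_def using True by (simp add: algebra_simps)
      finally show ?thesis using False lat[OF True] by (simp add: on_lattice_def)
    next
      case not_lat: False
      then show ?thesis using False by (simp add: R_def restriction_def on_lattice_def \<phi>_def F_def)
    qed
  qed
  have "R (restriction f) \<in> t_space" using sum unfolding pointwise[symmetric] .
  moreover have "w + 1 \<noteq> 0" using m by (simp add: w_def)
  ultimately show ?thesis using averagedI[OF R] by blast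
qed

text \<open>
Each Taylor coefficient in n is homogeneous and covered by \<open>homogeneous_h_space\<close>; the remainder
has order low enough to be absolutely summable. As that order is controlled only far from the
origin, the terms at the lattice point 0, where the coefficients have no meaning, can be dropped.
\<close>

lemma shifted_homogeneous_h_space:
  fixes f :: "real ^ 'k \<Rightarrow> complex"
  assumes smooth: "smooth_on f (UNIV - {0})" and hom: "homogeneous_of_type f (- s) \<epsilon>"
    and eps: "\<epsilon> \<in> {1, - 1}"
    and neq: "\<And>i::nat. (s, \<epsilon>) \<noteq> (of_nat CARD('k) - of_nat i, (- 1) ^ i)"
  shows "on_lattice (\<lambda>n. f (x + real_of_rat_vec n)) \<in> h_space"
proof -
  define p where "p = Re (- s)"
  define N where "N = nat \<lceil>p + 2 * real CARD('k)\<rceil>"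
  define a where "a = (\<lambda>i. restriction (dir_deriv i x f))"
  define u where "u = (\<lambda>n. f (x + real_of_rat_vec n) - (\<Sum>i<N. (1 / fact i) * a i n))"
  have "symbol N p f" unfolding p_def by (rule homogeneous_symbol[OF smooth hom])
  from taylor_remainder_order[OF this, of x] obtain C K where CK: "C \<ge> 0" "K > 0"
    "\<And>y t. norm y \<ge> K \<Longrightarrow> t \<in> {0..1} \<Longrightarrow>
      norm (f (y + t *\<^sub>R x) - (\<Sum>i<N. (t ^ i / fact i) *\<^sub>R dir_deriv i x f y)) \<le> C * norm y powr (p - N)"
    by blast
  have "on_lattice u \<in> abs_summable_functions"
    unfolding abs_summable_functions_def mem_Collect_eq
  proof (rule order_imp_lattice_summable)
    show "p - N \<le> - 2 * real CARD('k)"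
      using real_nat_ceiling_ge[of "p + 2 * real CARD('k)"] by (simp add: N_def)
    fix n :: "rat ^ 'k" assume n: "n \<in> int_lattice" "K \<le> norm (real_of_rat_vec n)"
    then have "n \<noteq> 0" using CK(2) real_of_rat_vec_eq_0_iff[of n] by fastforce
    then have "u n = f (real_of_rat_vec n + 1 *\<^sub>R x) - (\<Sum>i<N. (1 ^ i / fact i) *\<^sub>R dir_deriv i x f (real_of_rat_vec n))"
      using n by (simp add: u_def a_def restriction_def add.commute scaleR_conv_of_real)
    then show "norm (u n) \<le> C * norm (real_of_rat_vec n) powr (p - N)"
      using CK(3)[OF n(2), of 1] by simp
  qed
  then have "on_lattice u \<in> h_space" by (rule abs_summable_h_space)
  moreover have "(\<lambda>n. \<Sum>i<N. (1 / fact i) * a i n) \<in> h_space"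
  proof (intro H.averaged_sum H.averaged_scale finite_lessThan)
    fix i
    have h: "homogeneous_of_type (dir_deriv i x f) (- (s + of_nat i)) ((- 1) ^ i * \<epsilon>)"
      using homogeneous_iterated_dir_deriv(2)[OF smooth hom, of i x] by (simp add: algebra_simps)
    show "a i \<in> h_space" unfolding a_def
    proof (rule homogeneous_h_space[OF homogeneous_iterated_dir_deriv(1)[OF smooth hom] h])
      show "(- 1) ^ i * \<epsilon> \<in> {1, - 1}" using eps by (cases "even i") auto
      show "(s + of_nat i, (- 1) ^ i * \<epsilon>) \<noteq> (of_nat CARD('k), 1)"
      proof
        assume *: "(s + of_nat i, (- 1) ^ i * \<epsilon>) = (of_nat CARD('k), 1)"
        then have "s = of_nat CARD('k) - of_nat i" by (simp add: algebra_simps)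
        moreover have "\<epsilon> = (- 1) ^ i" using * eps by (cases "even i") auto
        ultimately show False using neq[of i] by simp
      qed
    qed
  qed
  ultimately have sum: "(\<lambda>n. on_lattice u n + (\<Sum>i<N. (1 / fact i) * a i n)) \<in> h_space"
    by (rule H.averaged_add)
  have "on_lattice u n + (\<Sum>i<N. (1 / fact i) * a i n) = on_lattice (\<lambda>n. f (x + real_of_rat_vec n)) n" for n
    by (simp add: on_lattice_def u_def a_def restriction_def)
  then show ?thesis using sum by (simp flip: fun_eq_iff)
qed

theorem proposition4p3:
  fixes f :: "real ^ 'k \<Rightarrow> complex" and s :: complex and \<epsilon> :: int
  assumes "\<epsilon> \<in> {1, - 1}"
    and "smooth_on f (UNIV - {0})"
    and "homogeneous_of_type f (- s) \<epsilon>"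
  shows "((s, \<epsilon>) \<noteq> (of_nat CARD('k), 1) \<longrightarrow>
            h_summable_on (\<lambda>n. f (real_of_rat_vec n)) (int_lattice - {0})) \<and>
         (\<forall>x. x \<notin> int_lattice \<longrightarrow>
            (s, \<epsilon>) \<notin> {(of_nat CARD('k) - of_nat i, (- 1) ^ i) | i :: nat. True} \<longrightarrow>
            h_summable_on (\<lambda>n. f (x + real_of_rat_vec n)) int_lattice)"
proof (intro conjI impI allI)
  assume "(s, \<epsilon>) \<noteq> (of_nat CARD('k), 1)"
  from h_space_h_summable[OF homogeneous_h_space[OF assms(2,3,1) this]]
  show "h_summable_on (\<lambda>n. f (real_of_rat_vec n)) (int_lattice - {0})"
    unfolding h_summable_on_def restriction_def[abs_def] .
next
  fix x :: "real ^ 'k"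
  assume "(s, \<epsilon>) \<notin> {(of_nat CARD('k) - of_nat i, (- 1) ^ i) | i :: nat. True}"
  then have "(s, \<epsilon>) \<noteq> (of_nat CARD('k) - of_nat i, (- 1) ^ i)" for i :: nat by blast
  from h_space_h_summable[OF shifted_homogeneous_h_space[OF assms(2,3,1) this, of x]]
  show "h_summable_on (\<lambda>n. f (x + real_of_rat_vec n)) int_lattice"
    unfolding h_summable_on_def on_lattice_def[abs_def] .
qed

end
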